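(* There exist a continuous, strictly increasing weight distribution function $G:[0,\infty)\to[0,1]$ and non-decreasing functions $f_1,f_2:\mathbb{N}_0\to\mathbb{N}$ with the following properties: (i) the function $f_1$ is $G$-small but not $G$-explosive; (ii) the function $f_2$ is $G$-explosive but not $G$-small.
   Context: $\mathbb{N}=\{1,2,\dots\}$, $\mathbb{N}_0=\mathbb{N}\cup\{0\}$. $G$ is the distribution function of a non-negative random variable, and $G^{-1}(y)=\inf\{x\ge0: G(x)\ge y\}$ (with $\inf\emptyset=+\infty$). For $f:\mathbb{N}_0\to\mathbb{N}$, $T_f$ is the spherically symmetric rooted tree in which each node of generation $n$ (distance $n$ from the root) has exactly $f(n)$ children, and $T_f^G$ is the randomly weighted tree obtained by giving the edges of $T_f$ i.i.d. weights with distribution function $G$. For a rooted weighted tree $T$, $m_n(T)$ is the minimum, over paths from the root to a node of generation $n$, of the sum of the edge weights on the path. $T$ is explosive if $\lim_{n\to\infty}m_n(T)<\infty$. A non-decreasing $f$ is $G$-explosive if $T_f^G$ is explosive almost surely. A non-decreasing $f$ is $G$-small if $\sum_{n} G^{-1}(f(n)^{-1})<\infty$, where the sum is over $n\ge N$ for some $N\in\mathbb{N}_0$ (i.e. finitely many initial terms are ignored). *)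

theory Defs
  imports "HOL-Probability.Probability"
begin

section \<open>Weight distribution functions\<close>

text \<open>A distribution function is a total function on the reals; being that of a
  non-negative random variable, it vanishes on the negative half-line.\<close>

definition weight_distribution_function :: "(real \<Rightarrow> real) \<Rightarrow> bool" where
  "weight_distribution_function G \<longleftrightarrow>
     (\<exists>M. real_distribution M \<and> (AE x in M. 0 \<le> x) \<and> G = cdf M)"

text \<open>In the extended non-negative reals the infimum of the empty set is \<open>\<infinity>\<close>.\<close>

definition quantile :: "(real \<Rightarrow> real) \<Rightarrow> real \<Rightarrow> ennreal" where
  "quantile G y = Inf {ennreal x | x. 0 \<le> x \<and> y \<le> G x}"

lemma weight_law:
  assumes "weight_distribution_function G"
  shows "real_distribution (interval_measure G)" "cdf (interval_measure G) = G"
    "AE x in interval_measure G. 0 \<le> x"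
proof -
  obtain M where M: "real_distribution M" "AE x in M. 0 \<le> x" "G = cdf M"
    using assms by (auto simp: weight_distribution_function_def)
  interpret M: real_distribution M by fact
  show 1: "real_distribution (interval_measure G)"
    unfolding M(3)
    by (intro real_distribution_interval_measure M.cdf_nondecreasing M.cdf_is_right_cont
        M.cdf_lim_at_bot M.cdf_lim_at_top_prob)
  show 2: "cdf (interval_measure G) = G"
    unfolding M(3)
    by (intro cdf_interval_measure M.cdf_nondecreasing M.cdf_is_right_cont M.cdf_lim_at_bot)
  have "interval_measure G = M"
    using cdf_unique[OF 1 M(1)] 2 M(3) by simp
  then show "AE x in interval_measure G. 0 \<le> x" by (rule ssubst) (fact M(2))
qed


section \<open>Spherically symmetric trees\<close>

text \<open>Ulam--Harris encoding of \<open>T\<^sub>f\<close>: the root is \<open>[]\<close>, and the children of a node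
  \<open>v\<close> of generation \<open>n = length v\<close> are the \<open>f n\<close> nodes \<open>v @ [k]\<close> with \<open>k < f n\<close>.\<close>

definition tree_nodes :: "(nat \<Rightarrow> nat) \<Rightarrow> nat list set" where
  "tree_nodes f = {v. \<forall>i<length v. v ! i < f i}"

definition generation :: "(nat \<Rightarrow> nat) \<Rightarrow> nat \<Rightarrow> nat list set" where
  "generation f n = {v \<in> tree_nodes f. length v = n}"

text \<open>An edge is named by its endpoint farther from the root.\<close>

definition tree_edges :: "(nat \<Rightarrow> nat) \<Rightarrow> nat list set" where
  "tree_edges f = tree_nodes f - {[]}"

lemma Nil_in_tree_nodes: "[] \<in> tree_nodes f"
  by (simp add: tree_nodes_def)

lemma child_in_tree_nodes_iff:
  "v @ [k] \<in> tree_nodes f \<longleftrightarrow> v \<in> tree_nodes f \<and> k < f (length v)"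
  by (auto simp: tree_nodes_def nth_append less_Suc_eq)

text \<open>The edges on the path from the root to \<open>v\<close> are the non-empty prefixes of \<open>v\<close>.\<close>

definition path_weight :: "(nat list \<Rightarrow> real) \<Rightarrow> nat list \<Rightarrow> real" where
  "path_weight w v = (\<Sum>i = 1..length v. w (take i v))"

definition min_weight :: "(nat \<Rightarrow> nat) \<Rightarrow> (nat list \<Rightarrow> real) \<Rightarrow> nat \<Rightarrow> real" where
  "min_weight f w n = Min (path_weight w ` generation f n)"

lemma finite_generation: "finite (generation f n)"
proof (rule finite_subset)
  show "generation f n \<subseteq> {v. set v \<subseteq> (\<Union>i<n. {..<f i}) \<and> length v = n}"
    by (fastforce simp: generation_def tree_nodes_def in_set_conv_nth)
qed (simp add: finite_lists_length_eq)

lemma generation_nonempty: "(\<And>n. 1 \<le> f n) \<Longrightarrow> generation f n \<noteq> {}"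
  by (auto simp: generation_def tree_nodes_def Suc_le_eq intro!: exI[of _ "replicate n 0"])

definition explosive :: "(nat \<Rightarrow> nat) \<Rightarrow> (nat list \<Rightarrow> real) \<Rightarrow> bool" where
  "explosive f w \<longleftrightarrow> lim (\<lambda>n. ereal (min_weight f w n)) < \<infinity>"

text \<open>The law of \<open>T\<^sub>f\<^sup>G\<close>. By \<open>weight_law\<close>, \<open>interval_measure G\<close> is the probability
  measure on the reals with distribution function \<open>G\<close>, so under this product measure the
  edge weights are i.i.d. with distribution function \<open>G\<close>.\<close>

definition random_tree_weights :: "(real \<Rightarrow> real) \<Rightarrow> (nat \<Rightarrow> nat) \<Rightarrow> (nat list \<Rightarrow> real) measure" where
  "random_tree_weights G f = (\<Pi>\<^sub>M e\<in>tree_edges f. interval_measure G)"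

definition G_explosive :: "(real \<Rightarrow> real) \<Rightarrow> (nat \<Rightarrow> nat) \<Rightarrow> bool" where
  "G_explosive G f \<longleftrightarrow> (AE w in random_tree_weights G f. explosive f w)"

definition G_small :: "(real \<Rightarrow> real) \<Rightarrow> (nat \<Rightarrow> nat) \<Rightarrow> bool" where
  "G_small G f \<longleftrightarrow> (\<exists>N. (\<Sum>n. quantile G (inverse (real (f (n + N))))) < \<infinity>)"

end

theory Submission
  imports Defs
begin

text \<open>
  The quantile \<open>G\<inverse>(1/f(n))\<close> measures the cheapest edge that a node of generation \<open>n\<close> can
  expect among its children. Greedy descent pays about this price in every generation, but the true
  cost of a descent can differ from it in both directions. Both effects are produced by one \<open>G\<close>
  that is almost flat on long stretches. Take points \<open>a\<^sub>0 > b\<^sub>0 > a\<^sub>1 > b\<^sub>1 > \<dots>\<close> tending to \<open>0\<close> and rapidly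
  growing integers \<open>E\<^sub>k\<close>, and let \<open>G(b\<^sub>k) = 1/(2E\<^sub>k)\<close> while \<open>G(a\<^sub>k)\<close> exceeds this value by a tiny amount only.

  A function that is \<open>G\<close>-small but not explosive: let \<open>f\<^sub>1 = 2E\<^sub>k\<close> on a block of \<open>L\<^sub>k\<close> generations.
  The quantile there is \<open>b\<^sub>k\<close>, and \<open>b\<^sub>k\<close> is chosen after \<open>L\<^sub>k\<close> so that \<open>L\<^sub>k b\<^sub>k\<close> is summable.
  But the edges of weight at most \<open>b\<^sub>k\<close> form a critical branching process, which dies out; the same is true
  of descents that may use a bounded number of heavier edges. If \<open>L\<^sub>k\<close> is large in terms of the number of nodes
  at the start of the block, then with high probability every path through the block uses at
  least \<open>h\<^sub>k \<ge> 1/a\<^sub>k\<close> edges that are heavier than \<open>b\<^sub>k\<close>. Because \<open>G\<close> is almost flat between \<open>b\<^sub>k\<close> and \<open>a\<^sub>k\<close>, these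
  edges are heavier even than \<open>a\<^sub>k\<close>, so each block costs at least \<open>h\<^sub>k a\<^sub>k \<ge> 1\<close>. This is
  \<open>not_AE_explosive\<close> fed with \<open>nearly_critical_descent_prob\<close>.

  A function that is explosive but not \<open>G\<close>-small: let \<open>f\<^sub>2 = E\<^sub>k\<close> on a block of \<open>h\<^sub>k\<close> generations. Since
  \<open>G(a\<^sub>k) < 1/E\<^sub>k\<close>, the quantile is at least \<open>a\<^sub>k\<close> and every block contributes at least \<open>1\<close> to the sum. But a
  path that pays \<open>b\<^bsub>k-1\<^esub>\<close> for the first edge of the block can take edges of weight at most \<open>b\<^sub>k\<close> for the rest:
  the first generation yields about \<open>E\<^sub>k/(2E\<^bsub>k-1\<^esub>)\<close> candidates, and when \<open>E\<^sub>k\<close> is huge in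
  comparison with \<open>4\<^bsup>h\<^sub>k\<^esup>E\<^bsub>k-1\<^esub>\<close>, some of them survive the subcritical remainder of the block
  (\<open>survival_lower_bound\<close>). The total price \<open>b\<^bsub>k-1\<^esub> + h\<^sub>k b\<^sub>k\<close> of a block is summable.

  Both arguments use one exact recursion (\<open>prob_descent\<close>) for the probability that some path
  descends a given number of generations with fewer than \<open>r\<close> heavy edges. The parameters
  are chosen in the cyclic order \<open>a\<^sub>k, h\<^sub>k, E\<^sub>k, L\<^sub>k, G(a\<^sub>k), b\<^sub>k, a\<^bsub>k+1\<^esub>\<close>, each in terms of the earlier ones.
\<close>

section \<open>Independence of disjoint sets of edges\<close>

lemma (in prob_space) indep_coordinates:
  assumes "I \<noteq> {}"
  shows "prob_space.indep_vars (PiM I (\<lambda>_. M)) (\<lambda>_. M) (\<lambda>i w. w i) I"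
proof -
  interpret P: prob_space "PiM I (\<lambda>_. M)"
    by (intro prob_space_PiM prob_space_axioms)
  have "distr (PiM I (\<lambda>_. M)) (PiM I (\<lambda>_. M)) (\<lambda>w. \<lambda>i\<in>I. w i) = distr (PiM I (\<lambda>_. M)) (PiM I (\<lambda>_. M)) (\<lambda>w. w)"
    by (intro distr_cong) (auto simp: space_PiM)
  moreover have "(\<Pi>\<^sub>M i\<in>I. distr (PiM I (\<lambda>_. M)) M (\<lambda>w. w i)) = PiM I (\<lambda>_. M)"
    by (intro PiM_cong refl distr_PiM_component prob_space_axioms)
  ultimately show ?thesis
    using assms by (subst P.indep_vars_iff_distr_eq_PiM') (auto simp: distr_id)
qed

text \<open>Equality of \<open>Q\<close> at \<open>w\<close> and at its restriction makes \<open>Q\<close> meaningful on every product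
  over a superset of \<open>K\<close>, so that independence of disjoint sets of coordinates can be applied to
  predicates without naming the restrictions.\<close>

definition determined_by :: "'i set \<Rightarrow> 'a measure \<Rightarrow> (('i \<Rightarrow> 'a) \<Rightarrow> bool) \<Rightarrow> bool" where
  "determined_by K M Q \<longleftrightarrow>
     {w \<in> space (PiM K (\<lambda>_. M)). Q w} \<in> sets (PiM K (\<lambda>_. M)) \<and> (\<forall>w. Q (restrict w K) = Q w)"

lemma determined_by_event:
  assumes "determined_by K M Q" "K \<subseteq> I"
  shows "{w \<in> space (PiM I (\<lambda>_. M)). Q w} \<in> sets (PiM I (\<lambda>_. M))"
proof -
  have restr: "(\<lambda>w. restrict w K) \<in> measurable (PiM I (\<lambda>_. M)) (PiM K (\<lambda>_. M))"
    using assms(2) by (rule measurable_restrict_subset)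
  from measurable_sets[OF restr, of "{w \<in> space (PiM K (\<lambda>_. M)). Q w}"] assms
  have "(\<lambda>w. restrict w K) -` {w \<in> space (PiM K (\<lambda>_. M)). Q w} \<inter> space (PiM I (\<lambda>_. M)) \<in> sets (PiM I (\<lambda>_. M))"
    by (simp add: determined_by_def)
  also have "(\<lambda>w. restrict w K) -` {w \<in> space (PiM K (\<lambda>_. M)). Q w} \<inter> space (PiM I (\<lambda>_. M))
     = {w \<in> space (PiM I (\<lambda>_. M)). Q w}"
    using assms(1) measurable_space[OF restr] by (auto simp: determined_by_def)
  finally show ?thesis .
qed

lemma determined_by_mono:
  fixes Q :: "('i \<Rightarrow> 'a) \<Rightarrow> bool"
  assumes "determined_by K M Q" "K \<subseteq> I"
  shows "determined_by I M Q"
  unfolding determined_by_def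
proof (intro conjI allI)
  show "{w \<in> space (PiM I (\<lambda>_. M)). Q w} \<in> sets (PiM I (\<lambda>_. M))"
    using assms by (rule determined_by_event)
next
  fix w :: "'i \<Rightarrow> 'a"
  have "restrict (restrict w I) K = restrict w K"
    using assms(2) by (simp add: Int_absorb1)
  then show "Q (restrict w I) = Q w"
    using assms(1) unfolding determined_by_def by metis
qed

lemma determined_by_coordinate:
  assumes "A \<in> sets M"
  shows "determined_by {i} M (\<lambda>w. w i \<in> A)"
proof -
  have "{w \<in> space (PiM {i} (\<lambda>_. M)). w i \<in> A} = (\<lambda>w. w i) -` A \<inter> space (PiM {i} (\<lambda>_. M))"
    by auto
  also have "\<dots> \<in> sets (PiM {i} (\<lambda>_. M))"
    using assms by (intro measurable_sets measurable_component_singleton) auto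
  finally show ?thesis by (simp add: determined_by_def)
qed

lemma determined_by_const: "determined_by K M (\<lambda>_. c)"
  by (cases c) (auto simp: determined_by_def)

lemma determined_by_not:
  assumes "determined_by K M Q"
  shows "determined_by K M (\<lambda>w. \<not> Q w)"
proof -
  have "{w \<in> space (PiM K (\<lambda>_. M)). \<not> Q w} = space (PiM K (\<lambda>_. M)) - {w \<in> space (PiM K (\<lambda>_. M)). Q w}"
    by auto
  then show ?thesis using assms by (auto simp: determined_by_def)
qed

lemma determined_by_conj:
  assumes "determined_by K M Q" "determined_by K M R"
  shows "determined_by K M (\<lambda>w. Q w \<and> R w)"
proof -
  have "{w \<in> space (PiM K (\<lambda>_. M)). Q w \<and> R w}
      = {w \<in> space (PiM K (\<lambda>_. M)). Q w} \<inter> {w \<in> space (PiM K (\<lambda>_. M)). R w}"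
    by auto
  then show ?thesis using assms by (auto simp: determined_by_def)
qed

lemma determined_by_ex_less:
  fixes n :: nat
  assumes "\<And>k. k < n \<Longrightarrow> determined_by K M (Q k)"
  shows "determined_by K M (\<lambda>w. \<exists>k<n. Q k w)"
proof -
  have "{w \<in> space (PiM K (\<lambda>_. M)). \<exists>k<n. Q k w}
      = (\<Union>k\<in>{..<n}. {w \<in> space (PiM K (\<lambda>_. M)). Q k w})"
    by auto
  moreover have "\<dots> \<in> sets (PiM K (\<lambda>_. M))"
    using assms by (intro sets.finite_UN) (auto simp: determined_by_def)
  ultimately show ?thesis using assms by (auto simp: determined_by_def)
qed

text \<open>Restrictions of a family of independent coordinates to pairwise disjoint index sets are
  again independent.\<close>

lemma (in prob_space) prob_conj_disjoint:
  fixes I :: "'i set" and J :: "'j set"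
  assumes I: "I \<noteq> {}" and J: "finite J" "J \<noteq> {}"
    and Q: "\<And>j. j \<in> J \<Longrightarrow> determined_by (K j) M (Q j)"
    and K: "\<And>j. j \<in> J \<Longrightarrow> K j \<subseteq> I" "\<And>i j. i \<in> J \<Longrightarrow> j \<in> J \<Longrightarrow> i \<noteq> j \<Longrightarrow> K i \<inter> K j = {}"
  shows "measure (PiM I (\<lambda>_. M)) {w \<in> space (PiM I (\<lambda>_. M)). \<forall>j\<in>J. Q j w}
       = (\<Prod>j\<in>J. measure (PiM I (\<lambda>_. M)) {w \<in> space (PiM I (\<lambda>_. M)). Q j w})"
proof -
  interpret P: prob_space "PiM I (\<lambda>_. M)"
    by (intro prob_space_PiM prob_space_axioms)
  let ?R = "\<lambda>j w. restrict (\<lambda>i. w i) (K j)"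
  let ?A = "\<lambda>j. {w \<in> space (PiM (K j) (\<lambda>_. M)). Q j w}"
  have "P.indep_vars (\<lambda>j. PiM (K j) (\<lambda>_. M)) ?R J"
    using K by (intro P.indep_vars_restrict[OF indep_coordinates[OF I]])
      (auto simp: disjoint_family_on_def)
  then have "P.prob (\<Inter>j\<in>J. ?R j -` ?A j \<inter> space (PiM I (\<lambda>_. M)))
      = (\<Prod>j\<in>J. P.prob (?R j -` ?A j \<inter> space (PiM I (\<lambda>_. M))))"
    by (rule P.indep_varsD_finite) (use J Q in \<open>auto simp: determined_by_def\<close>)
  moreover have *: "?R j -` ?A j \<inter> space (PiM I (\<lambda>_. M)) = {w \<in> space (PiM I (\<lambda>_. M)). Q j w}" if "j \<in> J" for j
    using Q[OF that] measurable_space[OF measurable_restrict_subset[OF K(1)[OF that]]]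
    by (auto simp: determined_by_def)
  moreover have "(\<Inter>j\<in>J. ?R j -` ?A j \<inter> space (PiM I (\<lambda>_. M))) = {w \<in> space (PiM I (\<lambda>_. M)). \<forall>j\<in>J. Q j w}"
    using J(2) * by auto
  moreover have "(\<Prod>j\<in>J. P.prob (?R j -` ?A j \<inter> space (PiM I (\<lambda>_. M))))
      = (\<Prod>j\<in>J. P.prob {w \<in> space (PiM I (\<lambda>_. M)). Q j w})"
    by (intro prod.cong refl arg_cong[where f = P.prob] *)
  ultimately show ?thesis by (simp only:)
qed

section \<open>Descents with few bad edges\<close>

text \<open>\<open>descent f B m r v w\<close>: some path leads from \<open>v\<close> down \<open>m\<close> generations and has fewer than \<open>r\<close>
  bad edges, an edge below generation \<open>n\<close> being good if its weight lies in \<open>B n\<close>. The budget \<open>r = 0\<close> is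
  unsatisfiable and, by truncated subtraction, stays so.\<close>

primrec descent :: "(nat \<Rightarrow> nat) \<Rightarrow> (nat \<Rightarrow> real set) \<Rightarrow> nat \<Rightarrow> nat \<Rightarrow> nat list \<Rightarrow> (nat list \<Rightarrow> real) \<Rightarrow> bool" where
  "descent f B 0 r v w \<longleftrightarrow> 0 < r"
| "descent f B (Suc m) r v w \<longleftrightarrow>
     (\<exists>k<f (length v). descent f B m (if w (v @ [k]) \<in> B (length v) then r else r - 1) (v @ [k]) w)"

lemma descent_iff:
  assumes "v \<in> tree_nodes f"
  shows "descent f B m r v w \<longleftrightarrow>
    (\<exists>u. length u = m \<and> v @ u \<in> tree_nodes f \<and>
         (\<Sum>i<m. of_bool (w (v @ take (Suc i) u) \<notin> B (length v + i))) < r)"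
  using assms
proof (induction m arbitrary: r v)
  case 0
  then show ?case by simp
next
  case (Suc m)
  have cons: "(\<exists>u. length u = Suc m \<and> Q u) \<longleftrightarrow> (\<exists>k u. length u = m \<and> Q (k # u))"
    for Q :: "nat list \<Rightarrow> bool"
    by (auto simp: length_Suc_conv)
  let ?cost = "\<lambda>m v u. (\<Sum>i<m. of_bool (w (v @ take (Suc i) u) \<notin> B (length v + i))) :: nat"
  have cost: "?cost (Suc m) v (k # u) < r \<longleftrightarrow>
      ?cost m (v @ [k]) u < (if w (v @ [k]) \<in> B (length v) then r else r - 1)" for k u
    by (subst sum.lessThan_Suc_shift) (auto simp: less_diff_conv simp del: sum_of_bool_eq)
  have IH: "descent f B m s (v @ [k]) w \<longleftrightarrow>
      (\<exists>u. length u = m \<and> v @ k # u \<in> tree_nodes f \<and> ?cost m (v @ [k]) u < s)"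
    if "k < f (length v)" for k s
    using Suc.IH[of "v @ [k]" s] that Suc.prems by (simp add: child_in_tree_nodes_iff del: sum_of_bool_eq)
  have "descent f B (Suc m) r v w \<longleftrightarrow> (\<exists>k u. length u = m \<and> v @ k # u \<in> tree_nodes f \<and> ?cost (Suc m) v (k # u) < r)"
    (is "_ \<longleftrightarrow> ?R")
  proof
    assume "descent f B (Suc m) r v w"
    then obtain k where k: "k < f (length v)"
      "descent f B m (if w (v @ [k]) \<in> B (length v) then r else r - 1) (v @ [k]) w" by auto
    then show ?R
      unfolding cost using IH[OF k(1)] by blast
  next
    assume ?R
    then obtain k u where ku: "length u = m" "v @ k # u \<in> tree_nodes f" "?cost (Suc m) v (k # u) < r"
      by blast
    from ku(2) have "k < f (length v)"
      by (fastforce simp: tree_nodes_def nth_append dest: spec[of _ "length v"])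
    with ku IH show "descent f B (Suc m) r v w"
      unfolding cost descent.simps by blast
  qed
  also have "\<dots> \<longleftrightarrow> (\<exists>u. length u = Suc m \<and> v @ u \<in> tree_nodes f \<and> ?cost (Suc m) v u < r)"
    by (rule cons[symmetric])
  finally show ?case .
qed

text \<open>The edges on which the existence of a descent from \<open>v\<close> depends.\<close>

definition edges_below :: "(nat \<Rightarrow> nat) \<Rightarrow> nat list \<Rightarrow> nat list set" where
  "edges_below f v = {v @ u | u. u \<noteq> [] \<and> v @ u \<in> tree_nodes f}"

lemma edges_below_subset: "edges_below f v \<subseteq> tree_edges f"
  by (auto simp: edges_below_def tree_edges_def)

lemma branch_subset:
  assumes "v \<in> tree_nodes f" "k < f (length v)"
  shows "insert (v @ [k]) (edges_below f (v @ [k])) \<subseteq> edges_below f v"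
  using assms by (auto simp: edges_below_def child_in_tree_nodes_iff)

lemma determined_by_descent:
  assumes "\<And>n. B n \<in> sets M" "v \<in> tree_nodes f"
  shows "determined_by (edges_below f v) M (descent f B m r v)"
  using assms(2)
proof (induction m arbitrary: r v)
  case 0
  then show ?case by (auto intro: determined_by_const)
next
  case (Suc m)
  have *: "determined_by (edges_below f v) M
      (\<lambda>w. descent f B m (if w (v @ [k]) \<in> B (length v) then r else r - 1) (v @ [k]) w)"
    if k: "k < f (length v)" for k
  proof -
    let ?g = "\<lambda>w. w (v @ [k]) \<in> B (length v)"
    note sub = branch_subset[OF Suc.prems k]
    have D: "determined_by (edges_below f v) M (descent f B m r' (v @ [k]))" for r'
      using sub k Suc.prems by (intro determined_by_mono[OF Suc.IH]) (auto simp: child_in_tree_nodes_iff)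
    have g: "determined_by (edges_below f v) M ?g"
      using sub by (intro determined_by_mono[OF determined_by_coordinate] assms) auto
    have "determined_by (edges_below f v) M
      (\<lambda>w. \<not> (\<not> (?g w \<and> descent f B m r (v @ [k]) w) \<and> \<not> (\<not> ?g w \<and> descent f B m (r - 1) (v @ [k]) w)))"
      by (intro determined_by_not determined_by_conj g D)
    also have "(\<lambda>w. \<not> (\<not> (?g w \<and> descent f B m r (v @ [k]) w) \<and> \<not> (\<not> ?g w \<and> descent f B m (r - 1) (v @ [k]) w)))
        = (\<lambda>w. descent f B m (if ?g w then r else r - 1) (v @ [k]) w)"
      by auto
    finally show ?thesis .
  qed
  have "descent f B (Suc m) r v = (\<lambda>w. \<exists>k<f (length v). descent f B m (if w (v @ [k]) \<in> B (length v) then r else r - 1) (v @ [k]) w)"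
    by (rule ext) simp
  then show ?case
    using determined_by_ex_less[where Q = "\<lambda>k w. descent f B m (if w (v @ [k]) \<in> B (length v) then r else r - 1) (v @ [k]) w", OF *]
    by simp
qed

text \<open>The iteration for the survival probability of a branching process, with \<open>p n\<close> the
  probability that an edge below generation \<open>n\<close> is good and with the remaining budget as type.\<close>

primrec descent_prob :: "(nat \<Rightarrow> nat) \<Rightarrow> (nat \<Rightarrow> real) \<Rightarrow> nat \<Rightarrow> nat \<Rightarrow> nat \<Rightarrow> real" where
  "descent_prob f p 0 r n = of_bool (0 < r)"
| "descent_prob f p (Suc m) r n =
     1 - (1 - (p n * descent_prob f p m r (Suc n) + (1 - p n) * descent_prob f p m (r - 1) (Suc n))) ^ f n"

text \<open>The descents through different children of \<open>v\<close> depend on disjoint sets of edges, and for each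
  child the connecting edge is independent of the edges further down. Hence failure at \<open>v\<close> is the
  product over the children of their failure probabilities.\<close>

theorem prob_descent:
  fixes f :: "nat \<Rightarrow> nat" and B :: "nat \<Rightarrow> real set"
  assumes M: "prob_space M" and B: "\<And>n. B n \<in> sets M" and f: "\<And>n. 1 \<le> f n"
    and v: "v \<in> tree_nodes f"
  defines "P \<equiv> PiM (tree_edges f) (\<lambda>_. M)"
  shows "measure P {w \<in> space P. descent f B m r v w} = descent_prob f (\<lambda>n. measure M (B n)) m r (length v)"
  using v
proof (induction m arbitrary: r v)
  case 0
  interpret prob_space M by (rule M)
  interpret P: prob_space P
    unfolding P_def by (intro prob_space_PiM prob_space_axioms)
  show ?case using P.prob_space by simp
next
  case (Suc m)
  interpret prob_space M by (rule M)
  interpret P: prob_space P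
    unfolding P_def by (intro prob_space_PiM prob_space_axioms)
  let ?n = "length v" and ?p = "\<lambda>n. measure M (B n)"
  let ?good = "\<lambda>k w. w (v @ [k]) \<in> B ?n"
  let ?E = "\<lambda>k w. descent f B m (if ?good k w then r else r - 1) (v @ [k]) w"
  let ?K = "\<lambda>k. insert (v @ [k]) (edges_below f (v @ [k]))"
  have E: "tree_edges f \<noteq> {}"
    using f[of 0] child_in_tree_nodes_iff[of "[]" 0 f] by (auto simp: tree_edges_def Nil_in_tree_nodes)
  have child: "v @ [k] \<in> tree_nodes f" if "k < f ?n" for k
    using that Suc.prems by (simp add: child_in_tree_nodes_iff)
  have good: "determined_by {v @ [k]} M (?good k)" for k
    by (intro determined_by_coordinate B)
  have below: "determined_by (edges_below f (v @ [k])) M (descent f B m r' (v @ [k]))" if "k < f ?n" for k r'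
    by (intro determined_by_descent B child that)
  have KE: "?K k \<subseteq> tree_edges f" if "k < f ?n" for k
    using branch_subset[OF Suc.prems that] edges_below_subset[of f v] by blast
  have detE: "determined_by (?K k) M (?E k)" if k: "k < f ?n" for k
  proof -
    have g: "determined_by (?K k) M (?good k)" and d: "determined_by (?K k) M (descent f B m r' (v @ [k]))" for r'
      by (rule determined_by_mono[OF good] determined_by_mono[OF below[OF k]]; blast)+
    have "determined_by (?K k) M
      (\<lambda>w. \<not> (\<not> (?good k w \<and> descent f B m r (v @ [k]) w) \<and> \<not> (\<not> ?good k w \<and> descent f B m (r - 1) (v @ [k]) w)))"
      by (intro determined_by_not determined_by_conj g d)
    also have "(\<lambda>w. \<not> (\<not> (?good k w \<and> descent f B m r (v @ [k]) w) \<and> \<not> (\<not> ?good k w \<and> descent f B m (r - 1) (v @ [k]) w)))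
        = ?E k"
      by auto
    finally show ?thesis .
  qed
  have ev: "{w \<in> space P. ?E k w} \<in> P.events" if "k < f ?n" for k
    unfolding P_def using determined_by_event[OF detE[OF that] KE[OF that]] .
  have pgood: "P.prob {w \<in> space P. ?good k w} = ?p ?n" if "k < f ?n" for k
  proof -
    have "v @ [k] \<in> tree_edges f" using KE[OF that] by auto
    then have "distr P M (\<lambda>w. w (v @ [k])) = M"
      unfolding P_def by (intro distr_PiM_component prob_space_axioms)
    then have "?p ?n = measure (distr P M (\<lambda>w. w (v @ [k]))) (B ?n)" by simp
    also have "\<dots> = P.prob ((\<lambda>w. w (v @ [k])) -` B ?n \<inter> space P)"
      using B \<open>v @ [k] \<in> tree_edges f\<close> unfolding P_def
      by (intro measure_distr measurable_component_singleton)
    also have "(\<lambda>w. w (v @ [k])) -` B ?n \<inter> space P = {w \<in> space P. ?good k w}" by auto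
    finally show ?thesis by simp
  qed
  have two: "P.prob {w \<in> space P. Q w \<and> R w} = P.prob {w \<in> space P. Q w} * P.prob {w \<in> space P. R w}"
    if k: "k < f ?n" and Q: "determined_by {v @ [k]} M Q" and R: "determined_by (edges_below f (v @ [k])) M R" for k Q R
  proof -
    have "P.prob {w \<in> space P. \<forall>j\<in>UNIV. case_bool Q R j w} = (\<Prod>j\<in>UNIV. P.prob {w \<in> space P. case_bool Q R j w})"
      unfolding P_def
    proof (rule prob_conj_disjoint[OF E, where K = "\<lambda>j. case_bool {v @ [k]} (edges_below f (v @ [k])) j"])
      fix j :: bool
      show "case_bool {v @ [k]} (edges_below f (v @ [k])) j \<subseteq> tree_edges f"
        using KE[OF k] by (cases j) auto
    qed (use Q R in \<open>auto split: bool.splits simp: edges_below_def\<close>)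
    moreover have "(\<forall>j\<in>UNIV. case_bool Q R j w) \<longleftrightarrow> Q w \<and> R w" for w
      by (auto split: bool.split)
    moreover have "(\<Prod>j\<in>UNIV. g j) = g True * g False" for g :: "bool \<Rightarrow> real"
      by (simp add: UNIV_bool mult.commute)
    ultimately show ?thesis by simp
  qed
  have pE: "P.prob {w \<in> space P. ?E k w}
      = ?p ?n * descent_prob f ?p m r (Suc ?n) + (1 - ?p ?n) * descent_prob f ?p m (r - 1) (Suc ?n)"
    if k: "k < f ?n" for k
  proof -
    have IH: "P.prob {w \<in> space P. descent f B m r' (v @ [k]) w} = descent_prob f ?p m r' (Suc ?n)" for r'
      using Suc.IH[OF child[OF k]] by simp
    have gev: "{w \<in> space P. ?good k w} \<in> P.events" 
      unfolding P_def by (rule determined_by_event[OF good]) (use KE[OF k] in auto)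
    have dev: "{w \<in> space P. descent f B m r' (v @ [k]) w} \<in> P.events" for r'
      unfolding P_def by (rule determined_by_event[OF below[OF k]]) (use KE[OF k] in auto)
    have "{w \<in> space P. \<not> ?good k w} = space P - {w \<in> space P. ?good k w}" by auto
    then have nb: "P.prob {w \<in> space P. \<not> ?good k w} = 1 - ?p ?n"
      using P.prob_compl[OF gev] pgood[OF k] by simp
    have split: "{w \<in> space P. ?E k w} = {w \<in> space P. ?good k w \<and> descent f B m r (v @ [k]) w}
       \<union> {w \<in> space P. \<not> ?good k w \<and> descent f B m (r - 1) (v @ [k]) w}" by auto
    have "P.prob {w \<in> space P. ?E k w} = P.prob {w \<in> space P. ?good k w \<and> descent f B m r (v @ [k]) w}
       + P.prob {w \<in> space P. \<not> ?good k w \<and> descent f B m (r - 1) (v @ [k]) w}"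
      unfolding split
    proof (rule P.finite_measure_Union)
      have "{w \<in> space P. ?good k w \<and> descent f B m r (v @ [k]) w}
        = {w \<in> space P. ?good k w} \<inter> {w \<in> space P. descent f B m r (v @ [k]) w}" by auto
      then show "{w \<in> space P. ?good k w \<and> descent f B m r (v @ [k]) w} \<in> P.events" using gev dev by simp
      have "{w \<in> space P. \<not> ?good k w \<and> descent f B m (r - 1) (v @ [k]) w}
        = {w \<in> space P. descent f B m (r - 1) (v @ [k]) w} - {w \<in> space P. ?good k w}" by auto
      then show "{w \<in> space P. \<not> ?good k w \<and> descent f B m (r - 1) (v @ [k]) w} \<in> P.events" using gev dev by simp
    qed auto
    then show ?thesis
      unfolding two[OF k good below[OF k]] two[OF k determined_by_not[OF good] below[OF k]] IH nb pgood[OF k] .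
  qed
  have "P.prob {w \<in> space P. \<forall>k\<in>{..<f ?n}. \<not> ?E k w} = (\<Prod>k<f ?n. P.prob {w \<in> space P. \<not> ?E k w})"
    unfolding P_def
  proof (rule prob_conj_disjoint[OF E, where K = ?K])
    show "{..<f ?n} \<noteq> {}" using f[of ?n] by (auto simp: lessThan_empty_iff)
    show "?K k \<inter> ?K l = {}" if "k \<noteq> l" for k l
      using that by (auto simp: edges_below_def)
    show "determined_by (?K k) M (\<lambda>w. \<not> ?E k w)" if "k \<in> {..<f ?n}" for k
      using that by (intro determined_by_not detE) simp
    show "?K k \<subseteq> tree_edges f" if "k \<in> {..<f ?n}" for k
      using that KE by blast
  qed simp
  also have "\<dots> = (1 - (?p ?n * descent_prob f ?p m r (Suc ?n) + (1 - ?p ?n) * descent_prob f ?p m (r - 1) (Suc ?n))) ^ f ?n"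
  proof -
    have "P.prob {w \<in> space P. \<not> ?E k w} = 1 - P.prob {w \<in> space P. ?E k w}" if "k < f ?n" for k
    proof -
      have "{w \<in> space P. \<not> ?E k w} = space P - {w \<in> space P. ?E k w}" by auto
      then show ?thesis using P.prob_compl[OF ev[OF that]] by simp
    qed
    then show ?thesis using pE by simp
  qed
  finally have none: "P.prob {w \<in> space P. \<forall>k\<in>{..<f ?n}. \<not> ?E k w}
      = (1 - (?p ?n * descent_prob f ?p m r (Suc ?n) + (1 - ?p ?n) * descent_prob f ?p m (r - 1) (Suc ?n))) ^ f ?n" .
  have D: "{w \<in> space P. descent f B (Suc m) r v w} \<in> P.events"
    unfolding P_def by (rule determined_by_event[OF determined_by_descent[OF B Suc.prems] edges_below_subset])
  have "{w \<in> space P. \<forall>k\<in>{..<f ?n}. \<not> ?E k w} = space P - {w \<in> space P. descent f B (Suc m) r v w}"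
    by auto
  then show ?case
    using P.prob_compl[OF D] none by simp
qed

section \<open>Extinction of critical descents\<close>

lemma descent_prob_range:
  assumes "\<And>i. 0 \<le> p i" "\<And>i. p i \<le> 1"
  shows "0 \<le> descent_prob f p m r n" "descent_prob f p m r n \<le> 1"
proof -
  have "0 \<le> descent_prob f p m r n \<and> descent_prob f p m r n \<le> 1"
  proof (induction m arbitrary: r n)
    case (Suc m)
    let ?a = "p n * descent_prob f p m r (Suc n) + (1 - p n) * descent_prob f p m (r - 1) (Suc n)"
    have "0 \<le> ?a" using Suc assms[of n] by (intro add_nonneg_nonneg mult_nonneg_nonneg) auto
    moreover have "?a \<le> 1"
      using Suc assms[of n] by (intro convex_bound_le) auto
    ultimately have "0 \<le> (1 - ?a) ^ f n" "(1 - ?a) ^ f n \<le> 1"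
      by (auto intro!: power_le_one)
    then show ?case by simp
  qed simp
  then show "0 \<le> descent_prob f p m r n" "descent_prob f p m r n \<le> 1" by simp_all
qed

lemma descent_prob_0: "(\<And>n. 1 \<le> f n) \<Longrightarrow> descent_prob f p m 0 n = 0"
  by (induction m arbitrary: n) (simp_all add: power_0_left Suc_le_eq)

lemma descent_prob_cong:
  assumes "\<And>i. i < m \<Longrightarrow> f (n + i) = f' (n' + i)" "\<And>i. i < m \<Longrightarrow> p (n + i) = p' (n' + i)"
  shows "descent_prob f p m r n = descent_prob f' p' m r n'"
  using assms
proof (induction m arbitrary: r n n')
  case (Suc m)
  have "descent_prob f p m r (Suc n) = descent_prob f' p' m r (Suc n')" for r
    by (intro Suc.IH) (use Suc.prems[of "Suc _"] in auto)
  then show ?case using Suc.prems(1)[of 0] Suc.prems(2)[of 0] by simp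
qed simp

text \<open>If all edges of the first \<open>m\<close> generations are good, a descent has to succeed from
  one of the nodes \<open>m\<close> generations further down; the product counts them.\<close>

lemma descent_prob_union_bound:
  assumes "\<And>i. 0 \<le> p i" "\<And>i. p i \<le> 1" "\<And>i. i < m \<Longrightarrow> p (n + i) = 1"
  shows "descent_prob f p (m + l) r n \<le> (\<Prod>i<m. real (f (n + i))) * descent_prob f p l r (n + m)"
  using assms(3)
proof (induction m arbitrary: n)
  case (Suc m)
  let ?d = "descent_prob f p (m + l) r (Suc n)"
  have "p n = 1" using Suc.prems[of 0] by simp
  then have "descent_prob f p (Suc m + l) r n = 1 - (1 - ?d) ^ f n" by simp
  also have "\<dots> \<le> real (f n) * ?d"
    using Bernoulli_inequality[of "- ?d" "f n"] descent_prob_range(2)[OF assms(1,2), where m = "m + l" and r = r and n = "Suc n"] by simp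
  also have "\<dots> \<le> real (f n) * ((\<Prod>i<m. real (f (Suc n + i))) * descent_prob f p l r (Suc n + m))"
    by (intro mult_left_mono Suc.IH) (use Suc.prems[of "Suc _"] in auto)
  finally show ?case by (subst prod.lessThan_Suc_shift) (simp add: mult.assoc)
qed simp

lemma strict_Bernoulli:
  fixes x :: real
  assumes "0 < x" "x \<le> 1" "2 \<le> n"
  shows "1 - n * x < (1 - x) ^ n"
proof -
  obtain m where m: "n = Suc m" "0 < m" using assms(3) by (cases n) auto
  have "1 - n * x < (1 - x) * (1 - m * x)"
    using assms m by (simp add: algebra_simps)
  also have "\<dots> \<le> (1 - x) * (1 - x) ^ m"
    using Bernoulli_inequality[of "- x" m] assms by (intro mult_left_mono) auto
  finally show ?thesis using m by simp
qed

text \<open>A critical branching process with a bounded budget of bad edges dies out. The probabilities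
  decrease in \<open>m\<close>, so they have a limit \<open>l\<close>; once the limit for the smaller budget is known to
  be \<open>0\<close>, the limit satisfies \<open>1 - l = (1 - l/F)\<^sup>F\<close>, and the strict Bernoulli
  inequality leaves only \<open>l = 0\<close>.\<close>

lemma critical_descent_prob_tendsto_0:
  fixes F :: nat
  assumes F: "2 \<le> F" 
  shows "(\<lambda>m. descent_prob (\<lambda>_. F) (\<lambda>_. 1 / F) m r 0) \<longlonglongrightarrow> 0"
proof (induction r)
  case 0
  then show ?case using F by (subst descent_prob_0) auto
next
  case (Suc r)
  let ?s = "descent_prob (\<lambda>_. F) (\<lambda>_. 1 / real F)"
  have p: "0 \<le> 1 / real F" "1 / real F \<le> 1" using F by auto
  have shift: "?s m r n = ?s m r 0" for m r n by (rule descent_prob_cong) auto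
  note range = descent_prob_range[where f = "\<lambda>_. F" and p = "\<lambda>_. 1 / real F", OF p]
  have step: "?s (Suc m) r 0 = 1 - (1 - (1 / F * ?s m r 0 + (1 - 1 / F) * ?s m (r - 1) 0)) ^ F" for m r
    by (simp add: shift[of _ _ "Suc 0"])
  have dec: "?s (Suc m) r 0 \<le> ?s m r 0" for m r
  proof (induction m arbitrary: r)
    case 0
    show ?case
    proof (cases r)
      case 0
      then show ?thesis using F descent_prob_0[of "\<lambda>_. F"] by auto
    qed (use range(2)[of "Suc 0" r 0] in simp)
  next
    case (Suc m)
    let ?a = "\<lambda>m. 1 / F * ?s m r 0 + (1 - 1 / F) * ?s m (r - 1) 0"
    have "?a (Suc m) \<le> ?a m"
      using p by (intro add_mono mult_left_mono Suc.IH) auto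
    moreover have "?a m \<le> 1"
      using p range by (intro convex_bound_le) auto
    ultimately have "(1 - ?a m) ^ F \<le> (1 - ?a (Suc m)) ^ F"
      by (intro power_mono) linarith+
    then show ?case
      using step[of "Suc m" r] step[of m r] by linarith
  qed
  have "decseq (\<lambda>m. ?s m (Suc r) 0)" by (intro decseq_SucI dec)
  then obtain l where l: "(\<lambda>m. ?s m (Suc r) 0) \<longlonglongrightarrow> l"
    using decseq_convergent[of "\<lambda>m. ?s m (Suc r) 0" 0] range(1) by metis
  have "0 \<le> l" by (rule LIMSEQ_le_const[OF l]) (use range in auto)
  have "l \<le> 1" by (rule LIMSEQ_le_const2[OF l]) (use range in auto)
  have "(\<lambda>m. ?s (Suc m) (Suc r) 0) \<longlonglongrightarrow> 1 - (1 - (1 / F * l + (1 - 1 / F) * 0)) ^ F"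
    unfolding step using l Suc.IH by (intro tendsto_intros) simp_all
  from LIMSEQ_unique[OF this LIMSEQ_Suc[OF l]]
  have fixpoint: "1 - l = (1 - l / F) ^ F" by simp
  have "l = 0"
  proof (rule ccontr)
    assume "l \<noteq> 0"
    then have "1 - F * (l / F) < (1 - l / F) ^ F"
      using F \<open>0 \<le> l\<close> \<open>l \<le> 1\<close> by (intro strict_Bernoulli) (auto simp: field_simps)
    then show False using fixpoint F by simp
  qed
  with l show ?case by simp
qed

lemma continuous_descent_prob: "continuous_on UNIV (\<lambda>p. descent_prob f (\<lambda>_. p) m r n)"
  by (induction m arbitrary: r n) (auto intro!: continuous_intros)

text \<open>Extinction within finitely many generations survives a small increase of the
  critical probability, because for fixed \<open>m\<close> the descent probability is a polynomial in \<open>p\<close>. The slack is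
  needed since a strictly increasing \<open>G\<close> cannot be constant between \<open>b\<^sub>k\<close> and \<open>a\<^sub>k\<close>.\<close>

lemma nearly_critical_descent_prob:
  fixes F :: nat
  assumes "2 \<le> F" "0 < \<epsilon>" "0 < N"
  obtains L p where "1 \<le> L" "1 / F < p" "p < 2 / F" "N * descent_prob (\<lambda>_. F) (\<lambda>_. p) L r 0 \<le> \<epsilon>"
proof -
  have "0 < \<epsilon> / N" using assms by simp
  with critical_descent_prob_tendsto_0[OF assms(1), of r]
  have "eventually (\<lambda>m. descent_prob (\<lambda>_. F) (\<lambda>_. 1 / F) m r 0 < \<epsilon> / N) sequentially"
    by (rule order_tendstoD)
  then have "eventually (\<lambda>m. descent_prob (\<lambda>_. F) (\<lambda>_. 1 / F) m r 0 < \<epsilon> / N \<and> 1 \<le> m) sequentially"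
    using eventually_ge_at_top by (rule eventually_conj)
  then obtain L where L: "1 \<le> L" "descent_prob (\<lambda>_. F) (\<lambda>_. 1 / F) L r 0 < \<epsilon> / N"
    by (auto simp: eventually_sequentially)
  have "((\<lambda>p. descent_prob (\<lambda>_. F) (\<lambda>_. p) L r 0) \<longlongrightarrow> descent_prob (\<lambda>_. F) (\<lambda>_. 1 / F) L r 0) (at_right (1 / F))"
    using continuous_descent_prob[of "\<lambda>_. F" L r 0]
    by (auto simp: continuous_on_def intro: tendsto_within_subset)
  from order_tendstoD(2)[OF this L(2)]
  have "eventually (\<lambda>p. descent_prob (\<lambda>_. F) (\<lambda>_. p) L r 0 < \<epsilon> / N) (at_right (1 / F))" .
  moreover have "eventually (\<lambda>p. p \<in> {1 / F <..< 2 / F}) (at_right (1 / real F))"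
    using assms by (intro eventually_at_right_real) (auto simp: field_simps)
  ultimately have "eventually (\<lambda>p. descent_prob (\<lambda>_. F) (\<lambda>_. p) L r 0 < \<epsilon> / N \<and> p \<in> {1 / F <..< 2 / F}) (at_right (1 / real F))"
    by (rule eventually_conj)
  then obtain p where "descent_prob (\<lambda>_. F) (\<lambda>_. p) L r 0 < \<epsilon> / N" "p \<in> {1 / F <..< 2 / F}"
    using eventually_happens trivial_limit_at_right_real by blast
  with L show thesis using assms by (intro that[of L p]) (auto simp: field_simps)
qed

section \<open>Distribution functions with prescribed values\<close>

text \<open>The law is a mixture of the uniform distributions on the intervals between
  consecutive points, with the increments of \<open>v\<close> as masses, and of an exponential tail beyond \<open>x 0\<close>
  that carries the remaining mass.\<close>

lemma exists_weight_distribution_through: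
  fixes x v :: "nat \<Rightarrow> real"
  assumes x: "\<And>k. x (Suc k) < x k" "x \<longlonglongrightarrow> 0"
    and v: "\<And>k. v (Suc k) < v k" "v \<longlonglongrightarrow> 0" "v 0 < 1"
  obtains G where "weight_distribution_function G" "continuous_on {0..} G" "strict_mono_on {0..} G"
    "\<And>k. G (x k) = v k"
proof -
  define c where "c k = v k - v (Suc k)" for k
  define \<rho> where "\<rho> k t = max 0 (min 1 ((t - x (Suc k)) / (x k - x (Suc k))))" for k and t :: real
  \<comment> \<open>\<open>\<rho> k\<close> and \<open>T\<close> are the distribution functions of the components.\<close>
  define T where "T t = 1 - exp (- max 0 (t - x 0))" for t
  define S where "S t = (\<Sum>k. c k * \<rho> k t)" for t
  define G where "G t = (1 - v 0) * T t + S t" for t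
  have c: "0 < c k" for k using v(1)[of k] by (simp add: c_def)
  have csum: "(\<lambda>k. c (k + j)) sums v j" for j
    using telescope_sums'[OF LIMSEQ_ignore_initial_segment[OF v(2), of j]] by (simp add: c_def)
  have dec: "decseq x" "decseq v" using x(1) v(1) by (auto intro!: decseq_SucI less_imp_le)
  have xpos: "0 < x k" for k
    using decseq_ge[OF dec(1) x(2), of "Suc k"] x(1)[of k] by linarith
  have \<rho>: "0 \<le> \<rho> k t" "\<rho> k t \<le> 1" for k t by (auto simp: \<rho>_def)
  have \<rho>_0: "\<rho> k t = 0" if "t \<le> x (Suc k)" for k t
    using that x(1)[of k] by (simp add: \<rho>_def divide_nonpos_pos)
  have \<rho>_1: "\<rho> k t = 1" if "x k \<le> t" for k t
    using that x(1)[of k] by (simp add: \<rho>_def)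
  have \<rho>_mono: "\<rho> k s \<le> \<rho> k t" if "s \<le> t" for k s t
    unfolding \<rho>_def using that x(1)[of k]
    by (intro max.mono min.mono divide_right_mono order_refl) auto
  have \<rho>_strict: "\<rho> k s < \<rho> k t" if "s < t" "s < x k" "x (Suc k) < t" for k s t
  proof -
    let ?d = "x k - x (Suc k)"
    have d: "0 < ?d" using x(1)[of k] by simp
    have "(s - x (Suc k)) / ?d < (t - x (Suc k)) / ?d" "(s - x (Suc k)) / ?d < 1" "0 < (t - x (Suc k)) / ?d"
      using that d by (auto simp: divide_strict_right_mono)
    then show ?thesis unfolding \<rho>_def by linarith
  qed
  have bnd: "norm (c k * \<rho> k t) \<le> c k" for k t
    using \<rho>[of k t] c[of k] by (simp add: abs_mult mult_left_le)
  have sc: "summable c" using csum[of 0] by (simp add: sums_iff)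
  have sm: "summable (\<lambda>k. c k * \<rho> k t)" for t
    using bnd by (intro summable_comparison_test[OF _ sc]) auto
  have "continuous_on UNIV S"
  proof (rule uniform_limit_theorem)
    show "uniform_limit UNIV (\<lambda>n t. \<Sum>k<n. c k * \<rho> k t) S sequentially"
      unfolding S_def using bnd sc by (intro Weierstrass_m_test) auto
    show "\<forall>\<^sub>F n in sequentially. continuous_on UNIV (\<lambda>t. \<Sum>k<n. c k * \<rho> k t)"
      using x(1) by (auto simp: \<rho>_def less_imp_neq[THEN not_sym] intro!: always_eventually continuous_intros)
  qed simp
  then have contG: "continuous_on UNIV G"
    unfolding G_def T_def by (intro continuous_intros)
  have T_mono: "T s \<le> T t" if "s \<le> t" for s t
    using that by (simp add: T_def)
  have S_mono: "S s \<le> S t" if "s \<le> t" for s t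
    unfolding S_def using that sm c by (intro suminf_le mult_left_mono \<rho>_mono) (auto simp: less_imp_le)
  have G_mono: "G s \<le> G t" if "s \<le> t" for s t
    unfolding G_def using that v(3) by (intro add_mono mult_left_mono T_mono S_mono) auto
  have G_strict: "G s < G t" if "0 \<le> s" "s < t" for s t
  proof (cases "x 0 \<le> s")
    case True
    then have "T s < T t" using that by (simp add: T_def)
    then show ?thesis
      unfolding G_def using v(3) S_mono[of s t] that by (intro add_less_le_mono mult_strict_left_mono) auto
  next
    case False
    have "eventually (\<lambda>k. x k < t) sequentially" using order_tendstoD(2)[OF x(2), of t] that by simp
    then have "\<exists>k. x (Suc k) < t" unfolding eventually_sequentially using le_SucI by blast
    then obtain k where k: "x (Suc k) < t" "\<And>j. j < k \<Longrightarrow> \<not> x (Suc j) < t"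
      using exists_least_iff[of "\<lambda>k. x (Suc k) < t"] by blast
    have "s < x k" using k(2)[of "k - 1"] False that by (cases k) auto
    have "0 < (\<Sum>j. c j * \<rho> j t - c j * \<rho> j s)"
    proof (rule suminf_pos2[OF summable_diff[OF sm sm]])
      show "0 \<le> c j * \<rho> j t - c j * \<rho> j s" for j
        using \<rho>_mono[of s t j] that c[of j] by (simp add: mult_left_mono)
      show "0 < c k * \<rho> k t - c k * \<rho> k s"
        using \<rho>_strict[OF that(2) \<open>s < x k\<close> k(1)] c[of k] by simp
    qed
    then have "S s < S t" unfolding S_def by (simp add: suminf_diff[OF sm sm, symmetric])
    then show ?thesis
      unfolding G_def using v(3) T_mono[of s t] that by (intro add_le_less_mono mult_left_mono) auto
  qed
  have G_neg: "G t = 0" if "t \<le> 0" for t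
  proof -
    have "\<rho> k t = 0" for k using xpos[of "Suc k"] that by (intro \<rho>_0) simp
    moreover have "T t = 0" using xpos[of 0] that by (simp add: T_def)
    ultimately show ?thesis by (simp add: G_def S_def)
  qed
  have S_x: "S (x j) = v j" for j
  proof -
    have "(\<lambda>k. c (k + j) * \<rho> (k + j) (x j)) sums v j"
      using csum[of j] dec(1) by (simp add: \<rho>_1 decseqD)
    moreover have "c k * \<rho> k (x j) = 0" if "k < j" for k
      using dec(1) that by (simp add: \<rho>_0 decseqD)
    ultimately have "(\<lambda>k. c k * \<rho> k (x j)) sums v j"
      using sums_zero_iff_shift[of j "\<lambda>k. c k * \<rho> k (x j)" "v j"] by simp
    then show ?thesis by (simp add: S_def sums_iff)
  qed
  have G_x: "G (x j) = v j" for j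
    using decseqD[OF dec(1), of 0 j] by (simp add: G_def T_def S_x)
  have bot: "(G \<longlongrightarrow> 0) at_bot"
    by (rule tendsto_eventually) (auto simp: eventually_at_bot_linorder G_neg intro!: exI[of _ 0])
  have top: "(G \<longlongrightarrow> 1) at_top"
  proof -
    have "S t = v 0" if "x 0 \<le> t" for t
    proof -
      have "\<rho> k t = 1" for k
        using that decseqD[OF dec(1), of 0 k] by (intro \<rho>_1) simp
      then show ?thesis using csum[of 0] by (simp add: S_def sums_iff)
    qed
    then have "eventually (\<lambda>t. (1 - v 0) * (1 - exp (x 0) * exp (- t)) + v 0 = G t) at_top"
      by (auto simp: eventually_at_top_linorder G_def T_def exp_diff exp_minus divide_inverse intro!: exI[of _ "x 0"])
    moreover have "((\<lambda>t. exp (- t :: real)) \<longlongrightarrow> 0) at_top"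
      by (rule filterlim_compose[OF exp_at_bot filterlim_uminus_at_bot_at_top])
    then have "((\<lambda>t. (1 - v 0) * (1 - exp (x 0) * exp (- t)) + v 0) \<longlongrightarrow> (1 - v 0) * (1 - exp (x 0) * 0) + v 0) at_top"
      by (intro tendsto_intros)
    ultimately show ?thesis by (simp add: Lim_transform_eventually)
  qed
  have right: "continuous (at_right a) G" for a
    using contG continuous_on_eq_continuous_at[OF open_UNIV] continuous_at_imp_continuous_at_within by blast
  interpret D: real_distribution "interval_measure G"
    by (intro real_distribution_interval_measure G_mono right bot top)
  have cdf: "cdf (interval_measure G) = G"
    by (intro cdf_interval_measure G_mono right bot)
  have "D.prob {..0} = 0" using fun_cong[OF cdf, of 0] G_neg[of 0] by (simp add: cdf_def)
  then have "AE t in interval_measure G. t \<notin> {..0}"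
    by (auto simp: AE_iff_null null_sets_def D.emeasure_eq_measure atMost_def)
  then have "AE t in interval_measure G. 0 \<le> t" by eventually_elim auto
  with cdf have "weight_distribution_function G"
    unfolding weight_distribution_function_def using D.real_distribution_axioms by metis
  then show thesis
    using continuous_on_subset[OF contG] G_strict G_x
    by (intro that[of G]) (auto intro!: strict_mono_onI)
qed

lemma quantile_le:
  assumes "0 \<le> x" "y \<le> G x"
  shows "quantile G y \<le> ennreal x"
  unfolding quantile_def using assms by (intro Inf_lower) auto

lemma quantile_ge:
  assumes "strict_mono_on {0..} G" "0 \<le> x" "G x < y"
  shows "ennreal x \<le> quantile G y"
  unfolding quantile_def
proof (rule Inf_greatest)
  fix z assume "z \<in> {ennreal x | x. 0 \<le> x \<and> y \<le> G x}"
  then obtain t where t: "z = ennreal t" "0 \<le> t" "y \<le> G t" by auto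
  have "x \<le> t"
  proof (rule ccontr)
    assume "\<not> x \<le> t"
    then have "G t < G x" using t assms by (intro strict_mono_onD[OF assms(1)]) auto
    then show False using t assms by simp
  qed
  then show "ennreal x \<le> z" using t by (simp add: ennreal_leI)
qed

section \<open>Blocks of generations\<close>

text \<open>The generations are cut into consecutive blocks of lengths \<open>l 0, l 1, \<dots>\<close>; the degree functions will be
  constant on blocks.\<close>

definition block_start :: "(nat \<Rightarrow> nat) \<Rightarrow> nat \<Rightarrow> nat" where
  "block_start l k = (\<Sum>j<k. l j)"

definition block :: "(nat \<Rightarrow> nat) \<Rightarrow> nat \<Rightarrow> nat" where
  "block l n = (LEAST k. n < block_start l (Suc k))"

lemma block_start_0 [simp]: "block_start l 0 = 0"
  by (simp add: block_start_def)

lemma block_start_Suc: "block_start l (Suc k) = block_start l k + l k"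
  by (simp add: block_start_def)

lemma mono_block_start: "i \<le> j \<Longrightarrow> block_start l i \<le> block_start l j"
  unfolding block_start_def by (intro sum_mono2) auto

context
  fixes l :: "nat \<Rightarrow> nat"
  assumes l: "\<And>k. 1 \<le> l k"
begin

lemma block_start_ge: "k \<le> block_start l k"
proof (induction k)
  case (Suc k)
  then show ?case using l[of k] by (simp add: block_start_Suc)
qed simp

lemma less_block_start_block: "n < block_start l (Suc (block l n))"
  unfolding block_def using Suc_le_lessD[OF block_start_ge[of "Suc n"]] by (rule LeastI[of _ n])

lemma block_start_block_le: "block_start l (block l n) \<le> n"
proof (cases "block l n")
  case (Suc k)
  then have "\<not> n < block_start l (Suc k)"
    unfolding block_def by (intro not_less_Least) simp
  with Suc show ?thesis by simp
qed simp

lemma mono_block: "m \<le> n \<Longrightarrow> block l m \<le> block l n"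
  unfolding block_def[of l m] using less_block_start_block[of n] by (intro Least_le) linarith

lemma block_start_less: "block_start l k < block_start l (Suc k)"
  using l[of k] by (simp add: block_start_Suc)

lemma block_eqI:
  assumes "block_start l k \<le> n" "n < block_start l (Suc k)"
  shows "block l n = k"
proof (rule antisym)
  show "block l n \<le> k" unfolding block_def using assms by (intro Least_le)
  show "k \<le> block l n"
  proof (rule ccontr)
    assume "\<not> k \<le> block l n"
    then have "block_start l (Suc (block l n)) \<le> block_start l k" by (intro mono_block_start) simp
    then show False using less_block_start_block[of n] assms by simp
  qed
qed

lemma block_block_start: "block l (block_start l k) = k"
  by (intro block_eqI block_start_less) simp

lemma sum_block:
  fixes g :: "nat \<Rightarrow> 'a :: comm_semiring_1"
  assumes "a \<le> b"
  shows "(\<Sum>i=block_start l a..<block_start l b. g (block l i)) = (\<Sum>k=a..<b. of_nat (l k) * g k)"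
  using assms
proof (induction b rule: dec_induct)
  case (step b)
  have "(\<Sum>i=block_start l b..<block_start l (Suc b). g (block l i))
      = (\<Sum>i=block_start l b..<block_start l (Suc b). g b)"
    by (intro sum.cong refl arg_cong[where f = g] block_eqI) auto
  also have "\<dots> = of_nat (l b) * g b" by (simp add: block_start_Suc)
  finally have "(\<Sum>i=block_start l b..<block_start l (Suc b). g (block l i)) = of_nat (l b) * g b" .
  moreover have "(\<Sum>i=block_start l a..<block_start l (Suc b). g (block l i))
      = (\<Sum>i=block_start l a..<block_start l b. g (block l i)) + (\<Sum>i=block_start l b..<block_start l (Suc b). g (block l i))"
    using step.hyps by (intro sum.atLeastLessThan_concat[symmetric] mono_block_start) auto
  ultimately show ?case using step by simp
qed simp

lemma prod_block:
  fixes g :: "nat \<Rightarrow> 'a :: comm_semiring_1"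
  shows "(\<Prod>i<block_start l K. g (block l i)) = (\<Prod>k<K. g k ^ l k)"
proof (induction K)
  case (Suc K)
  have "(\<Prod>i=block_start l K..<block_start l (Suc K). g (block l i))
      = (\<Prod>i=block_start l K..<block_start l (Suc K). g K)"
    by (intro prod.cong refl arg_cong[where f = g] block_eqI) auto
  then have "(\<Prod>i=block_start l K..<block_start l (Suc K). g (block l i)) = g K ^ l K"
    by (simp add: block_start_Suc)
  moreover have "(\<Prod>i=0..<block_start l (Suc K). g (block l i))
      = (\<Prod>i=0..<block_start l K. g (block l i)) * (\<Prod>i=block_start l K..<block_start l (Suc K). g (block l i))"
    by (intro prod.atLeastLessThan_concat[symmetric] mono_block_start) auto
  ultimately show ?case using Suc by (simp add: atLeast0LessThan)
qed simp

lemma suminf_block_le: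
  fixes g :: "nat \<Rightarrow> ennreal"
  shows "(\<Sum>n. g (block l n)) \<le> (\<Sum>k. of_nat (l k) * g k)"
proof (rule suminf_le_const)
  fix n
  have "(\<Sum>i<n. g (block l i)) \<le> (\<Sum>i<block_start l n. g (block l i))"
    by (rule sum_mono2) (simp_all add: block_start_ge)
  also have "\<dots> = (\<Sum>k<n. of_nat (l k) * g k)"
    using sum_block[of 0 n g] by (simp add: atLeast0LessThan)
  also have "\<dots> \<le> (\<Sum>k. of_nat (l k) * g k)"
    by (rule sum_le_suminf) auto
  finally show "(\<Sum>i<n. g (block l i)) \<le> (\<Sum>k. of_nat (l k) * g k)" .
qed simp

text \<open>Since block \<open>N\<close> starts at generation \<open>N\<close> or later, omitting \<open>N\<close> terms still
  leaves all blocks from the \<open>N\<close>-th one on.\<close>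

lemma suminf_block_tail_eq_top:
  fixes g :: "nat \<Rightarrow> ennreal"
  assumes "\<And>k. 1 \<le> of_nat (l k) * g k"
  shows "(\<Sum>n. g (block l (n + N))) = \<infinity>"
proof -
  have "of_nat J \<le> (\<Sum>n. g (block l (n + N)))" for J
  proof -
    have "of_nat J = (\<Sum>k=N..<N + J. 1 :: ennreal)" by simp
    also have "\<dots> \<le> (\<Sum>k=N..<N + J. of_nat (l k) * g k)"
      by (intro sum_mono assms)
    also have "\<dots> = (\<Sum>i=block_start l N..<block_start l (N + J). g (block l i))"
      by (rule sum_block[symmetric]) simp
    also have "\<dots> \<le> (\<Sum>i=N..<block_start l (N + J). g (block l i))"
      using block_start_ge[of N] by (intro sum_mono2) auto
    also have "\<dots> = (\<Sum>n=0..<block_start l (N + J) - N. g (block l (n + N)))"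
      using block_start_ge[of "N + J"] sum.shift_bounds_nat_ivl[of "\<lambda>i. g (block l i)" 0 N "block_start l (N + J) - N"] by simp
    also have "\<dots> \<le> (\<Sum>n. g (block l (n + N)))"
      by (rule sum_le_suminf) auto
    finally show ?thesis .
  qed
  then show ?thesis
    by (metis ennreal_Ex_less_of_nat infinity_ennreal_def less_top not_le)
qed

end

section \<open>Criteria for explosion\<close>

lemma path_weight_eq: "path_weight w v = (\<Sum>i<length v. w (take (Suc i) v))"
  unfolding path_weight_def by (rule sum_bounds_lt_plus1[symmetric])

lemma path_weight_take:
  assumes "n \<le> length v"
  shows "path_weight w v = path_weight w (take n v) + (\<Sum>i=n..<length v. w (take (Suc i) v))"
proof -
  have "(\<Sum>i<n. w (take (Suc i) (take n v))) = (\<Sum>i<n. w (take (Suc i) v))"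
    by (intro sum.cong) (auto simp: min_def)
  then show ?thesis
    using assms sum.atLeastLessThan_concat[of 0 n "length v" "\<lambda>i. w (take (Suc i) v)"]
    by (simp add: path_weight_eq atLeast0LessThan min_def)
qed

lemma take_in_generation:
  assumes "v \<in> generation f m" "n \<le> m"
  shows "take n v \<in> generation f n"
  using assms by (auto simp: generation_def tree_nodes_def)

lemma take_in_tree_edges:
  assumes "v \<in> generation f m" "i < m"
  shows "take (Suc i) v \<in> tree_edges f"
  using take_in_generation[OF assms(1), of "Suc i"] assms(2) by (auto simp: tree_edges_def generation_def)

lemma min_weight_ge:
  assumes "\<And>n. 1 \<le> f n" "\<And>v. v \<in> generation f n \<Longrightarrow> c \<le> path_weight w v"
  shows "c \<le> min_weight f w n"
  unfolding min_weight_def using assms generation_nonempty[of f n] finite_generation[of f n]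
  by (subst Min_ge_iff) auto

lemma min_weight_le:
  assumes "v \<in> generation f n" "path_weight w v \<le> c"
  shows "min_weight f w n \<le> c"
  unfolding min_weight_def using assms finite_generation[of f n] by (auto intro: Min.coboundedI order_trans)

lemma incseq_min_weight:
  assumes f: "\<And>n. 1 \<le> f n" and w: "\<And>e. e \<in> tree_edges f \<Longrightarrow> 0 \<le> w e"
  shows "incseq (min_weight f w)"
proof (rule incseq_SucI, rule min_weight_ge[OF f])
  fix n v assume v: "v \<in> generation f (Suc n)"
  then have "length v = Suc n" by (simp add: generation_def)
  then have "path_weight w (take n v) \<le> path_weight w v"
    using path_weight_take[of n v w] w[OF take_in_tree_edges[OF v, of n]] by simp
  then show "min_weight f w n \<le> path_weight w v"
    using take_in_generation[OF v, of n] by (intro min_weight_le) auto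
qed

text \<open>For non-negative weights the minimal path weights increase, so the limit in the
  definition of explosion exists and is their supremum.\<close>

lemma explosive_iff_bounded:
  assumes f: "\<And>n. 1 \<le> f n" and w: "\<And>e. e \<in> tree_edges f \<Longrightarrow> 0 \<le> w e"
  shows "explosive f w \<longleftrightarrow> (\<exists>C. \<forall>n. min_weight f w n \<le> C)"
proof -
  let ?X = "\<lambda>n. ereal (min_weight f w n)"
  have "incseq ?X" using incseq_min_weight[OF assms] by (auto simp: incseq_def)
  then have "lim ?X = (SUP n. ?X n)" by (intro limI LIMSEQ_SUP)
  then have "explosive f w \<longleftrightarrow> (SUP n. ?X n) < \<infinity>" by (simp add: explosive_def)
  also have "\<dots> \<longleftrightarrow> (\<exists>C. \<forall>n. min_weight f w n \<le> C)"
  proof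
    assume *: "(SUP n. ?X n) < \<infinity>"
    have "?X 0 \<le> (SUP n. ?X n)" by (rule SUP_upper) simp
    with * obtain C where C: "(SUP n. ?X n) = ereal C" by (cases "SUP n. ?X n") auto
    have "min_weight f w n \<le> C" for n
      using SUP_upper[of n UNIV ?X] unfolding C by simp
    then show "\<exists>C. \<forall>n. min_weight f w n \<le> C" by blast
  next
    assume "\<exists>C. \<forall>n. min_weight f w n \<le> C"
    then obtain C where "\<And>n. min_weight f w n \<le> C" by blast
    then have "(SUP n. ?X n) \<le> ereal C" by (intro SUP_least) simp
    then show "(SUP n. ?X n) < \<infinity>" using le_less_trans by fastforce
  qed
  finally show ?thesis .
qed

text \<open>From the root, the recursion speaks about the paths of a generation and their number of
  bad edges.\<close>

lemma descent_root_iff: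
  "descent f B m r [] w \<longleftrightarrow>
    (\<exists>v\<in>generation f m. card {i. i < m \<and> w (take (Suc i) v) \<notin> B i} < r)"
proof -
  have "(\<Sum>i<m. of_bool (w (take (Suc i) v) \<notin> B i)) = card {i. i < m \<and> w (take (Suc i) v) \<notin> B i}" for v
    by (simp add: Collect_conj_eq lessThan_def)
  then show ?thesis
    by (subst descent_iff) (auto simp: Nil_in_tree_nodes generation_def simp del: sum_of_bool_eq)
qed

context
  fixes f :: "nat \<Rightarrow> nat" and M :: "real measure"
  assumes f: "\<And>n. 1 \<le> f n" and M: "real_distribution M" and nonneg: "AE x in M. 0 \<le> x"
begin

interpretation M: real_distribution M by (rule M)

abbreviation (input) tree_law :: "(nat list \<Rightarrow> real) measure" where
  "tree_law \<equiv> PiM (tree_edges f) (\<lambda>_. M)"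

interpretation P: prob_space tree_law
  by (intro prob_space_PiM M.prob_space_axioms)

lemma AE_weights_nonneg: "AE w in tree_law. \<forall>e\<in>tree_edges f. 0 \<le> w e"
proof (subst AE_ball_countable)
  show "countable (tree_edges f)" by (rule countableI_type)
  show "\<forall>e\<in>tree_edges f. AE w in tree_law. 0 \<le> w e"
    by (intro ballI AE_PiM_component nonneg M.prob_space_axioms)
qed

lemma descent_event:
  assumes "\<And>n. B n \<in> sets borel"
  shows "{w \<in> space tree_law. descent f B m r [] w} \<in> sets tree_law"
  using assms by (intro determined_by_event[OF determined_by_descent edges_below_subset]) (auto simp: Nil_in_tree_nodes)

lemma prob_descent_thresholds:
  "P.prob {w \<in> space tree_law. descent f (\<lambda>n. if n < K then UNIV else {..c n}) m r [] w}
    = descent_prob f (\<lambda>n. if n < K then 1 else cdf M (c n)) m r 0"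
proof -
  have "(\<lambda>n. M.prob (if n < K then UNIV else {..c n})) = (\<lambda>n. if n < K then 1 else cdf M (c n))"
    using M.prob_space by (auto simp: cdf_def fun_eq_iff)
  then show ?thesis
    using prob_descent[OF M.prob_space_axioms, of "\<lambda>n. if n < K then UNIV else {..c n}" f "[]" m r] f
    by (simp add: Nil_in_tree_nodes)
qed

text \<open>If, from some generation \<open>K\<close> on, arbitrarily long paths obey the thresholds \<open>c\<close>, then all minimal
  weights are bounded by the maximal weight of a path up to generation \<open>K\<close> plus the sum of \<open>c\<close>. The event
  that this happens for some \<open>K\<close> contains events of probability arbitrarily close to \<open>1\<close>.\<close>

lemma AE_explosive:
  assumes c: "summable c" "\<And>n. 0 \<le> c n"
    and survive: "\<And>\<epsilon>. 0 < \<epsilon> \<Longrightarrow> \<exists>K. \<forall>m. 1 - \<epsilon> \<le> descent_prob f (\<lambda>n. if n < K then 1 else cdf M (c n)) m 1 0"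
  shows "AE w in tree_law. explosive f w"
proof -
  let ?B = "\<lambda>K n. if n < K then UNIV else {..c n}"
  let ?D = "\<lambda>K m. {w \<in> space tree_law. descent f (?B K) m 1 [] w}"
  let ?S = "\<Union>K. \<Inter>m. ?D K m"
  have ev: "?D K m \<in> P.events" for K m by (rule descent_event) auto
  have S: "?S \<in> P.events" using ev by (intro sets.countable_UN sets.countable_INT) auto
  have ge: "1 - \<epsilon> \<le> P.prob ?S" if "0 < \<epsilon>" for \<epsilon>
  proof -
    obtain K where K: "\<And>m. 1 - \<epsilon> \<le> P.prob (?D K m)"
      using survive[OF \<open>0 < \<epsilon>\<close>] unfolding prob_descent_thresholds by blast
    have "decseq (?D K)"
    proof (rule decseq_SucI)
      fix m
      have "descent f (?B K) m 1 [] w" if desc: "descent f (?B K) (Suc m) 1 [] w" for w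
      proof -
        obtain v where v: "v \<in> generation f (Suc m)" "card {i. i < Suc m \<and> w (take (Suc i) v) \<notin> ?B K i} < 1"
          using desc unfolding descent_root_iff by blast
        have "card {i. i < m \<and> w (take (Suc i) (take m v)) \<notin> ?B K i} \<le> card {i. i < Suc m \<and> w (take (Suc i) v) \<notin> ?B K i}"
          by (intro card_mono) (auto simp: min_def)
        with v(2) have light: "card {i. i < m \<and> w (take (Suc i) (take m v)) \<notin> ?B K i} < 1" by (rule le_less_trans[rotated])
        show ?thesis
          unfolding descent_root_iff using light take_in_generation[OF v(1), of m]
          by (intro bexI[of _ "take m v"]) simp_all
      qed
      then show "?D K (Suc m) \<subseteq> ?D K m" by blast
    qed
    then have "(\<lambda>m. P.prob (?D K m)) \<longlonglongrightarrow> P.prob (\<Inter>m. ?D K m)"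
      using ev by (intro P.finite_Lim_measure_decseq) auto
    then have "1 - \<epsilon> \<le> P.prob (\<Inter>m. ?D K m)"
      using K by (intro LIMSEQ_le_const) auto
    also have "\<dots> \<le> P.prob ?S" using S by (intro P.finite_measure_mono) auto
    finally show ?thesis .
  qed
  have "1 \<le> P.prob ?S"
  proof (rule field_le_epsilon)
    fix \<epsilon> :: real assume "0 < \<epsilon>"
    from ge[OF this] show "1 \<le> P.prob ?S + \<epsilon>" by linarith
  qed
  then have "P.prob ?S = 1" using P.prob_le_1[of ?S] by (rule antisym[rotated])
  then have "AE w in tree_law. w \<in> ?S" by (rule P.AE_prob_1)
  then show ?thesis
    using AE_weights_nonneg
  proof eventually_elim
    case (elim w)
    then obtain K where K: "\<And>m. descent f (?B K) m 1 [] w" by auto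
    \<comment> \<open>All generations up to \<open>K\<close> are taken because a path may end before generation \<open>K\<close>.\<close>
    define A where "A = Max (insert 0 (path_weight w ` (\<Union>m\<le>K. generation f m)))"
    have A: "path_weight w v \<le> A" if "v \<in> generation f m" "m \<le> K" for v m
      unfolding A_def using that finite_generation by (intro Max_ge) auto
    have "min_weight f w n \<le> A + suminf c" for n
    proof -
      obtain v where v: "v \<in> generation f n" "card {i. i < n \<and> w (take (Suc i) v) \<notin> ?B K i} < 1"
        using K[of n] unfolding descent_root_iff by blast
      then have len: "length v = n" by (simp add: generation_def)
      have small: "w (take (Suc i) v) \<le> c i" if "i < n" "K \<le> i" for i
        using v(2) that by (auto split: if_splits)
      let ?m = "min K n"
      have "path_weight w v = path_weight w (take ?m v) + (\<Sum>i=?m..<n. w (take (Suc i) v))"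
        using path_weight_take[of ?m v w] len by simp
      also have "path_weight w (take ?m v) \<le> A"
        using take_in_generation[OF v(1), of ?m] by (intro A[of _ ?m]) auto
      also have "(\<Sum>i=?m..<n. w (take (Suc i) v)) \<le> (\<Sum>i=?m..<n. c i)"
        by (intro sum_mono small) auto
      also have "\<dots> \<le> suminf c"
        using c by (intro sum_le_suminf) auto
      finally show ?thesis using v(1) by (intro min_weight_le) auto
    qed
    then show ?case using explosive_iff_bounded[of f w] f elim by blast
  qed
qed

text \<open>With positive probability no stretch \<open>[t k, t (k + 1))\<close> of generations can be crossed with fewer than
  \<open>r k\<close> edges heavier than \<open>a k\<close>. Then each stretch adds at least \<open>r k * a k \<ge> 1\<close> to the weight of every path.\<close>

lemma not_AE_explosive:
  fixes t r :: "nat \<Rightarrow> nat" and a \<epsilon> :: "nat \<Rightarrow> real"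
  assumes t: "\<And>k. t k \<le> t (Suc k)"
    and a: "\<And>k. 0 \<le> a k" "\<And>k. 1 \<le> r k * a k"
    and \<epsilon>: "summable \<epsilon>" "suminf \<epsilon> < 1"
    and die: "\<And>k. descent_prob f (\<lambda>n. if n < t k then 1 else cdf M (a k)) (t (Suc k)) (r k) 0 \<le> \<epsilon> k"
  shows "\<not> (AE w in tree_law. explosive f w)"
proof
  assume expl: "AE w in tree_law. explosive f w"
  let ?B = "\<lambda>k n. if n < t k then UNIV else {..a k}"
  let ?D = "\<lambda>k. {w \<in> space tree_law. descent f (?B k) (t (Suc k)) (r k) [] w}"
  have ev: "?D k \<in> P.events" for k by (rule descent_event) auto
  have le: "P.prob (?D k) \<le> \<epsilon> k" for k
    using die[of k] prob_descent_thresholds[of "t k" "\<lambda>_. a k" "t (Suc k)" "r k"] by simp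
  have sm: "summable (\<lambda>k. P.prob (?D k))"
    using le by (intro summable_comparison_test[OF _ \<epsilon>(1)]) auto
  have "P.prob (\<Union>k. ?D k) \<le> (\<Sum>k. P.prob (?D k))"
    using ev sm by (intro P.finite_measure_subadditive_countably) auto
  also have "\<dots> \<le> suminf \<epsilon>" by (intro suminf_le le sm \<epsilon>(1))
  finally have "P.prob (\<Union>k. ?D k) < 1" using \<epsilon>(2) by simp
  moreover have "AE w in tree_law. w \<in> (\<Union>k. ?D k)"
    using expl AE_weights_nonneg AE_space
  proof eventually_elim
    case (elim w)
    show ?case
    proof (rule ccontr)
      assume "w \<notin> (\<Union>k. ?D k)"
      then have heavy: "r k \<le> card {i. i < t (Suc k) \<and> w (take (Suc i) v) \<notin> ?B k i}"
        if "v \<in> generation f (t (Suc k))" for k v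
        using that elim(3) unfolding descent_root_iff by (auto simp: not_less)
      have "real k \<le> path_weight w v" if "v \<in> generation f (t k)" for k v
        using that
      proof (induction k arbitrary: v)
        case 0
        then show ?case
          using elim(2) take_in_tree_edges[OF 0] by (auto simp: path_weight_eq generation_def intro!: sum_nonneg)
      next
        case (Suc k)
        then have len: "length v = t (Suc k)" by (simp add: generation_def)
        let ?H = "{i. i < t (Suc k) \<and> w (take (Suc i) v) \<notin> ?B k i}"
        have H: "?H \<subseteq> {t k..<t (Suc k)}" by (auto split: if_splits)
        have "1 \<le> r k * a k" by (rule a)
        also have "\<dots> \<le> card ?H * a k"
          using heavy[OF Suc.prems] a(1) by (intro mult_right_mono) auto
        also have "\<dots> = (\<Sum>i\<in>?H. a k)" by simp
        also have "\<dots> \<le> (\<Sum>i\<in>?H. w (take (Suc i) v))"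
          by (intro sum_mono) (auto split: if_splits)
        also have "\<dots> \<le> (\<Sum>i=t k..<t (Suc k). w (take (Suc i) v))"
          using H elim(2) take_in_tree_edges[OF Suc.prems] by (intro sum_mono2) auto
        finally have "1 \<le> (\<Sum>i=t k..<t (Suc k). w (take (Suc i) v))" .
        moreover have "real k \<le> path_weight w (take (t k) v)"
          using take_in_generation[OF Suc.prems t[of k]] by (rule Suc.IH)
        ultimately show ?case
          using path_weight_take[of "t k" v w] t[of k] len by simp
      qed
      then have "real k \<le> min_weight f w (t k)" for k
        by (intro min_weight_ge f)
      moreover obtain C where "\<And>n. min_weight f w n \<le> C"
        using elim explosive_iff_bounded[of f w] f by blast
      ultimately have "real k \<le> C" for k using order_trans by blast
      then show False using reals_Archimedean2[of C] by (meson not_le)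
    qed
  qed
  then have "P.prob (\<Union>k. ?D k) = 1"
    using P.prob_eq_1[of "\<Union>k. ?D k"] ev by blast
  ultimately show False by linarith
qed

end

section \<open>Survival through subcritical blocks\<close>

text \<open>At least one of \<open>n\<close> independent trials succeeds with probability at least \<open>s/(1+s)\<close>, where \<open>s\<close> is the
  expected number of successes. This follows from \<open>(1-x)\<^sup>n (1+x)\<^sup>n \<le> 1\<close>, and it is good both for
  large \<open>s\<close> and, up to a constant factor, for small \<open>s\<close>.\<close>

lemma one_minus_power_ge:
  fixes x :: real
  assumes "0 \<le> x" "x \<le> 1"
  shows "n * x / (1 + n * x) \<le> 1 - (1 - x) ^ n"
proof -
  have "(1 - x) ^ n * (1 + n * x) \<le> (1 - x) ^ n * (1 + x) ^ n"
    using Bernoulli_inequality[of x n] assms by (intro mult_left_mono) auto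
  also have "\<dots> = (1 - x\<^sup>2) ^ n"
    by (simp add: power_mult_distrib[symmetric] algebra_simps power2_eq_square)
  also have "\<dots> \<le> 1" using assms by (intro power_le_one) (auto simp: power_le_one)
  finally have "(1 - x) ^ n \<le> 1 / (1 + n * x)"
    using assms by (simp add: field_simps add_pos_nonneg)
  moreover have "n * x / (1 + n * x) = 1 - 1 / (1 + n * x)"
    using assms by (simp add: field_simps add_pos_nonneg add_nonneg_eq_0_iff)
  ultimately show ?thesis by linarith
qed

text \<open>Backward induction. Inside a block a node has on average half a good child, and each
  generation costs at most a factor \<open>4\<close> in the survival probability; so right below the first generation
  of block \<open>k + 1\<close> it is still at least \<open>4\<^bsup>-h\<^esup>/2\<close> with \<open>h\<close> the block length. A node of the first generation has
  so many good children that this lifts the survival probability back to nearly \<open>1\<close>.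
  The bound at the start of a block does not depend on what is lost in later blocks, so nothing accumulates.\<close>

lemma survival_lower_bound:
  fixes E h :: "nat \<Rightarrow> nat" and p :: "nat \<Rightarrow> real"
  assumes h: "\<And>k. 1 \<le> h k"
    and E: "\<And>k. 1 \<le> E k" "\<And>k. E (Suc k) = 2 ^ (k + 3) * 4 ^ h (Suc k) * E k"
    and p_before: "\<And>n. n < block_start h (Suc K) \<Longrightarrow> p n = 1"
    and p_first: "\<And>k. K \<le> k \<Longrightarrow> p (block_start h (Suc k)) = 1 / (2 * E k)"
    and p_later: "\<And>n. block_start h (Suc K) \<le> n \<Longrightarrow> n \<noteq> block_start h (block h n) \<Longrightarrow> p n = 1 / (2 * E (block h n))"
  shows "1 - 1 / 2 ^ K \<le> descent_prob (\<lambda>n. E (block h n)) p m 1 0"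
proof -
  let ?f = "\<lambda>n. E (block h n)" and ?u = "block_start h"
  define Q where "Q m n = descent_prob ?f p m 1 n" for m n
  note block = block_start_block_le[where l = h, OF h] less_block_start_block[where l = h, OF h]
    block_eqI[where l = h, OF h] mono_block[where l = h, OF h]
  have block_ge: "Suc K \<le> block h n" if "?u (Suc K) \<le> n" for n
    using block(4)[OF that] block(3)[of "Suc K" "?u (Suc K)"] h[of "Suc K"] by (simp add: block_start_Suc)
  have half: "0 \<le> 1 / real (2 * e)" "1 / real (2 * e) \<le> 1" if "1 \<le> e" for e :: nat
    using that by auto
  have p: "0 \<le> p n \<and> p n \<le> 1" for n
  proof (cases "n < ?u (Suc K)")
    case False
    show ?thesis
    proof (cases "n = ?u (block h n)")
      case True
      obtain k where k: "block h n = Suc k" "K \<le> k"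
        using block_ge[of n] False by (cases "block h n") auto
      then have "p n = 1 / (2 * E k)" using p_first[of k] True by simp
      then show ?thesis using half[OF E(1)[of k]] by simp
    next
      case f: False
      then have "p n = 1 / (2 * E (block h n))" using False by (intro p_later) auto
      then show ?thesis using half[OF E(1)[of "block h n"]] by simp
    qed
  qed (simp add: p_before)
  have Q: "0 \<le> Q m n" "Q m n \<le> 1" for m n
    unfolding Q_def using p by (auto intro!: descent_prob_range)
  have Q_Suc: "Q (Suc m) n = 1 - (1 - p n * Q m (Suc n)) ^ ?f n" for m n
    unfolding Q_def using E(1) by (simp add: descent_prob_0)
  have Q_ge: "?f n * (p n * Q m (Suc n)) / (1 + ?f n * (p n * Q m (Suc n))) \<le> Q (Suc m) n" for m n
    unfolding Q_Suc using p[of n] Q[of m "Suc n"] by (intro one_minus_power_ge) (auto intro: mult_le_one)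
  have main: "(?u (block h n) = n \<longrightarrow> 1 - 1 / 2 ^ (block h n - 1) \<le> Q m n \<and> 1 / 2 \<le> Q m n) \<and>
      1 / 2 * (1 / 4) ^ (?u (Suc (block h n)) - n) \<le> Q m n"
    if "?u (Suc K) \<le> n" for m n
    using that
  proof (induction m arbitrary: n)
    case 0
    have "(1 / 4 :: real) ^ (?u (Suc (block h n)) - n) \<le> 1" by (intro power_le_one) auto
    then show ?case by (simp add: Q_def)
  next
    case (Suc m)
    obtain k where k: "block h n = Suc k" "K \<le> k"
      using block_ge[OF Suc.prems] by (cases "block h n") auto
    let ?d = "?u (Suc (Suc k)) - Suc n"
    have n: "?u (Suc k) \<le> n" "n < ?u (Suc (Suc k))" using block(1,2)[of n] k by auto
    have d: "?u (Suc (Suc k)) - n = Suc ?d" using n by simp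
    have child: "1 / 2 * (1 / 4) ^ ?d \<le> Q m (Suc n)"
    proof (cases "Suc n < ?u (Suc (Suc k))")
      case True
      then have "block h (Suc n) = Suc k" using n by (intro block(3)) auto
      then show ?thesis using Suc.IH[of "Suc n"] Suc.prems by simp
    next
      case False
      then have eq: "Suc n = ?u (Suc (Suc k))" using n by simp
      then have "block h (Suc n) = Suc (Suc k)" using h[of "Suc (Suc k)"] by (intro block(3)) (auto simp: block_start_Suc)
      then show ?thesis using Suc.IH[of "Suc n"] Suc.prems eq by simp
    qed
    have pow: "(1 / 4 :: real) ^ i \<le> 1" for i by (intro power_le_one) auto
    show ?case
    proof (cases "n = ?u (Suc k)")
      case True
      let ?x = "E (Suc k) * (p n * Q m (Suc n))"
      have "?d < h (Suc k)" using True h[of "Suc k"] by (simp add: block_start_Suc)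
      then have "(1 / 4 :: real) ^ h (Suc k) \<le> (1 / 4) ^ ?d" by (intro power_decreasing) auto
      then have q: "1 / 2 * (1 / 4) ^ h (Suc k) \<le> Q m (Suc n)" using child by linarith
      have pn: "p n = 1 / (2 * E k)" using p_first[OF k(2)] True by simp
      have "2 ^ (k + 1) = E (Suc k) * (p n * (1 / 2 * (1 / 4) ^ h (Suc k)))"
        unfolding pn E(2) using E(1)[of k] by (simp add: power_add field_simps power_divide)
      also have "\<dots> \<le> ?x"
        using q p[of n] by (intro mult_left_mono) auto
      finally have x: "2 ^ (k + 1) \<le> ?x" .
      have "(1 :: real) \<le> 2 ^ (k + 1)" by (rule one_le_power) simp
      with x have x1: "1 \<le> ?x" by linarith
      have "1 - 1 / 2 ^ (k + 1) \<le> 1 - 1 / (1 + ?x)"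
        by (intro diff_left_mono frac_le) (use x in auto)
      also have "\<dots> = ?x / (1 + ?x)" using x1 by (simp add: field_simps)
      also have "\<dots> \<le> Q (Suc m) n" using Q_ge[of n m] k by simp
      finally have 1: "1 - 1 / 2 ^ (k + 1) \<le> Q (Suc m) n" .
      have "(1 :: real) / 2 ^ (k + 1) \<le> 1 / 2 ^ k" "(1 :: real) / 2 ^ (k + 1) \<le> 1 / 2"
        by (auto simp: field_simps)
      with 1 have 2: "1 - 1 / 2 ^ k \<le> Q (Suc m) n" "1 / 2 \<le> Q (Suc m) n" by linarith+
      then show ?thesis using k pow[of "?u (Suc (block h n)) - n"] by simp
    next
      case False
      let ?x = "E (Suc k) * (p n * Q m (Suc n))"
      have "p n = 1 / (2 * E (Suc k))" using p_later[OF Suc.prems] False k by simp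
      then have x: "?x = Q m (Suc n) / 2" using E(1)[of "Suc k"] by simp
      have "Q m (Suc n) / 4 \<le> ?x / (1 + ?x)"
        unfolding x using Q[of m "Suc n"] mult_left_mono[OF Q(2)[of m "Suc n"] Q(1)[of m "Suc n"]]
        by (simp add: field_simps add_pos_nonneg)
      also have "\<dots> \<le> Q (Suc m) n" using Q_ge[of n m] k by simp
      finally have "Q m (Suc n) / 4 \<le> Q (Suc m) n" .
      with child have "1 / 2 * (1 / 4) ^ (Suc ?d) \<le> Q (Suc m) n" by simp
      then show ?thesis using k d False by simp
    qed
  qed
  have start: "1 - 1 / 2 ^ K \<le> Q m (?u (Suc K))" for m
  proof -
    have "block h (?u (Suc K)) = Suc K"
      using h[of "Suc K"] by (intro block(3)) (auto simp: block_start_Suc)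
    then show ?thesis using main[of "?u (Suc K)" m] by simp
  qed
  have "1 - 1 / 2 ^ K \<le> Q m n" if "n \<le> ?u (Suc K)" for m n
    using that
  proof (induction m arbitrary: n)
    case 0
    then show ?case by (simp add: Q_def)
  next
    case (Suc m)
    show ?case
    proof (cases "n = ?u (Suc K)")
      case False
      then have "p n = 1" using Suc.prems by (intro p_before) simp
      then have "Q (Suc m) n = 1 - (1 - Q m (Suc n)) ^ ?f n" by (simp add: Q_Suc)
      moreover have "(1 - Q m (Suc n)) ^ ?f n \<le> (1 - Q m (Suc n)) ^ 1"
        using Q E(1) by (intro power_decreasing) auto
      ultimately show ?thesis using Suc.IH[of "Suc n"] False Suc.prems by simp
    qed (use start in simp)
  qed
  then show ?thesis unfolding Q_def by simp
qed

section \<open>Choice of the parameters\<close>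

text \<open>\<open>E\<close> sets the degrees, \<open>h\<close> is both the length of the explosive function's blocks and the number of heavy
  edges forced in a block of the other function, whose lengths are \<open>L\<close>; and \<open>p k\<close> is the value prescribed
  for \<open>G (a k)\<close>. The product in the last condition is the number of nodes in the generation at which block \<open>k\<close> starts.\<close>

locale block_parameters =
  fixes E h L :: "nat \<Rightarrow> nat" and a b p :: "nat \<Rightarrow> real"
  assumes E_ge_1: "1 \<le> E k" and E_Suc: "E (Suc k) = 2 ^ (k + 3) * 4 ^ h (Suc k) * E k"
    and L_ge_1: "1 \<le> L k" and h_ge_1: "1 \<le> h k" and h_a: "1 \<le> h k * a k"
    and b_pos: "0 < b k" and b_less: "b k < a k" and a_le_1: "a k \<le> 1" and a_Suc: "a (Suc k) = b k / 2"
    and L_b: "L k * b k \<le> (1 / 2) ^ k" and h_b: "h k * b k \<le> (1 / 2) ^ k"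
    and p_gt: "1 / (2 * E k) < p k" and p_less: "p k < 1 / E k"
    and die_out: "(\<Prod>j<k. real (2 * E j) ^ L j) * descent_prob (\<lambda>_. 2 * E k) (\<lambda>_. p k) (L k) (h k) 0
      \<le> (1 / 2) ^ (k + 2)"

text \<open>Each choice constrains only later ones: \<open>h k\<close> is determined by \<open>a k\<close>, then \<open>E k\<close> by \<open>h k\<close>; extinction
  gives \<open>L k\<close> and \<open>p k\<close>, and finally \<open>b k\<close> is taken small in terms of the block lengths. The state of the
  recursion also carries the number \<open>N\<close> of nodes at the start of the block.\<close>

lemma exists_block_parameters: "\<exists>E h L a b p. block_parameters E h L a b p"
proof -
  \<comment> \<open>\<open>hits a\<close> edges of weight \<open>a\<close> weigh at least \<open>1\<close>; \<open>low k a L\<close> is the weight \<open>b\<close> that follows \<open>a\<close>.\<close>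
  define hits where "hits a = nat \<lceil>1 / a\<rceil>" for a :: real
  define low where "low k a L = a / (2 ^ (k + 1) * (real L + real (hits a)))" for k L :: nat and a :: real
  have hits: "1 \<le> real (hits a) * a" "1 \<le> hits a" if "0 < a" for a
  proof -
    have "1 / a \<le> real (hits a)" unfolding hits_def by (rule real_nat_ceiling_ge)
    then show "1 \<le> real (hits a) * a" using that by (simp add: field_simps)
    then show "1 \<le> hits a" by (cases "hits a") auto
  qed
  have low: "0 < low k a L" "low k a L < a" "real L * low k a L \<le> (1 / 2) ^ k" "real (hits a) * low k a L \<le> (1 / 2) ^ k"
    if "0 < a" "a \<le> 1" "1 \<le> L" for k a L
  proof -
    let ?d = "real L + real (hits a)"
    have d: "0 < ?d" "2 \<le> ?d" using that hits[of a] by auto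
    show pos: "0 < low k a L" unfolding low_def using that d by simp
    have eq: "?d * low k a L = a / 2 ^ (k + 1)" 
    proof -
      have "D * (a / (q * D)) = a / q" if "0 < D" for D q :: real using that by simp
      from this[OF d(1)] show ?thesis unfolding low_def .
    qed
    have "a / 2 ^ (k + 1) \<le> 1 / 2 ^ k" using that by (intro frac_le) auto
    then have le: "?d * low k a L \<le> (1 / 2) ^ k" unfolding eq by (simp add: power_divide)
    have "0 \<le> real L * low k a L" "0 \<le> real (hits a) * low k a L" using pos by simp_all
    with le show "real L * low k a L \<le> (1 / 2) ^ k" "real (hits a) * low k a L \<le> (1 / 2) ^ k"
      by (simp_all add: distrib_right)
    have "a / 2 ^ (k + 1) \<le> a / 1" using that one_le_power[of "2 :: real" "k + 1"] by (intro divide_left_mono) auto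
    moreover have "2 * low k a L \<le> ?d * low k a L" using pos d by (intro mult_right_mono) auto
    ultimately show "low k a L < a" using eq pos by simp
  qed
  define P where "P k = (\<lambda>(E :: nat, a :: real, N :: real, L :: nat, p :: real).
      1 \<le> E \<and> 0 < a \<and> a \<le> 1 \<and> 0 < N \<and> (k = 0 \<longrightarrow> N = 1) \<and> 1 \<le> L \<and> 1 / (2 * E) < p \<and> p < 1 / E \<and>
      N * descent_prob (\<lambda>_. 2 * E) (\<lambda>_. p) L (hits a) 0 \<le> (1 / 2) ^ (k + 2))" for k :: nat
  define R where "R k = (\<lambda>(E :: nat, a :: real, N :: real, L :: nat, p :: real) (E' :: nat, a' :: real, N' :: real, L' :: nat, p' :: real).
      a' = low k a L / 2 \<and> N' = N * real (2 * E) ^ L \<and> E' = 2 ^ (k + 3) * 4 ^ hits a' * E)" for k :: nat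
  have complete: "\<exists>L p. P k (E, a, N, L, p)" if "1 \<le> E" "0 < a" "a \<le> 1" "0 < N" "k = 0 \<longrightarrow> N = 1" for k E a N
  proof -
    have "2 \<le> 2 * E" "(0 :: real) < (1 / 2) ^ (k + 2)" using that by auto
    then obtain L p where "1 \<le> L" "1 / real (2 * E) < p" "p < 2 / real (2 * E)"
      "N * descent_prob (\<lambda>_. 2 * E) (\<lambda>_. p) L (hits a) 0 \<le> (1 / 2) ^ (k + 2)"
      using nearly_critical_descent_prob[of "2 * E" "(1 / 2) ^ (k + 2)" N "hits a"] \<open>0 < N\<close> by metis
    then show ?thesis using that by (auto simp: P_def intro!: exI[of _ L] exI[of _ p])
  qed
  obtain L p where "P 0 (1, 1, 1, L, p)" using complete[of 1 1 1 0] by auto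
  then have "\<exists>s. P 0 s" by blast
  moreover have "\<exists>s'. P (Suc k) s' \<and> R k s s'" if "P k s" for k s
  proof -
    obtain E a N L p where s: "s = (E, a, N, L, p)" by (cases s) auto
    define a' where "a' = low k a L / 2"
    have "0 < a'" "a' \<le> 1"
      using that low(1,2)[of a L k] by (auto simp: P_def s a'_def)
    moreover have "1 \<le> 2 ^ (k + 3) * 4 ^ hits a' * E" "0 < N * real (2 * E) ^ L"
      using that by (auto simp: P_def s Suc_le_eq)
    ultimately obtain L' p' where "P (Suc k) (2 ^ (k + 3) * 4 ^ hits a' * E, a', N * real (2 * E) ^ L, L', p')"
      using complete[of _ a' _ "Suc k"] by blast
    moreover have "R k s (2 ^ (k + 3) * 4 ^ hits a' * E, a', N * real (2 * E) ^ L, L', p')"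
      by (simp add: s R_def a'_def)
    ultimately show ?thesis by blast
  qed
  ultimately obtain s where s: "\<And>k. P k (s k)" "\<And>k. R k (s k) (s (Suc k))"
    using dependent_nat_choice[of P R] by metis
  define E where "E k = fst (s k)" for k
  define a where "a k = fst (snd (s k))" for k
  define N where "N k = fst (snd (snd (s k)))" for k
  define L where "L k = fst (snd (snd (snd (s k))))" for k
  define p where "p k = snd (snd (snd (snd (s k))))" for k
  have sk: "s k = (E k, a k, N k, L k, p k)" for k by (simp add: E_def a_def N_def L_def p_def)
  have step: "a (Suc k) = low k (a k) (L k) / 2" "N (Suc k) = N k * real (2 * E k) ^ L k"
    "E (Suc k) = 2 ^ (k + 3) * 4 ^ hits (a (Suc k)) * E k" for k
    using s(2)[of k] unfolding sk R_def by auto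
  have props: "1 \<le> E k" "0 < a k" "a k \<le> 1" "0 < N k" "1 \<le> L k" "1 / (2 * E k) < p k" "p k < 1 / E k"
    "N k * descent_prob (\<lambda>_. 2 * E k) (\<lambda>_. p k) (L k) (hits (a k)) 0 \<le> (1 / 2) ^ (k + 2)" for k
    using s(1)[of k] unfolding sk P_def by auto
  have "N 0 = 1" using s(1)[of 0] unfolding sk P_def by auto
  then have N: "N k = (\<Prod>j<k. real (2 * E j) ^ L j)" for k
    by (induction k) (simp_all add: step)
  have "block_parameters E (\<lambda>k. hits (a k)) L a (\<lambda>k. low k (a k) (L k)) p"
  proof
    fix k
    show "1 \<le> E k" "1 \<le> L k" "a k \<le> 1" "1 / real (2 * E k) < p k" "p k < 1 / real (E k)"
      by (rule props)+
    show "E (Suc k) = 2 ^ (k + 3) * 4 ^ hits (a (Suc k)) * E k" "a (Suc k) = low k (a k) (L k) / 2"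
      by (rule step)+
    show "1 \<le> hits (a k)" "1 \<le> real (hits (a k)) * a k"
      by (rule hits[OF props(2)])+
    show "0 < low k (a k) (L k)" "low k (a k) (L k) < a k" "real (L k) * low k (a k) (L k) \<le> (1 / 2) ^ k"
      "real (hits (a k)) * low k (a k) (L k) \<le> (1 / 2) ^ k"
      by (rule low[OF props(2,3,5)])+
    show "(\<Prod>j<k. real (2 * E j) ^ L j) * descent_prob (\<lambda>_. 2 * E k) (\<lambda>_. p k) (L k) (hits (a k)) 0 \<le> (1 / 2) ^ (k + 2)"
      using props(8)[of k] unfolding N .
  qed
  then show ?thesis by blast
qed

section \<open>The two degree functions\<close>

text \<open>Thresholds of \<open>b (k - 1)\<close> at the start of block \<open>k\<close> and of \<open>b k\<close> at its other generations. Both parts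
  are summable, the first as a series over blocks and the second because a block contributes at most \<open>h k * b k\<close>.\<close>

lemma summable_block_cost:
  fixes b c :: "nat \<Rightarrow> real" and h :: "nat \<Rightarrow> nat"
  assumes h: "\<And>k. 1 \<le> h k" and b: "\<And>k. 0 < b k" "\<And>k. h k * b k \<le> (1 / 2) ^ k"
    and c: "\<And>k. c (block_start h (Suc k)) = b k"
      "\<And>n. n \<noteq> block_start h (block h n) \<Longrightarrow> c n = b (block h n)"
      "\<And>n. 0 \<le> c n"
  shows "summable c"
proof -
  define first where "first n = (if n \<in> range (block_start h) then c n else 0)" for n
  have start: "strict_mono (block_start h)"
    using block_start_less[where l = h, OF h] by (simp add: strict_mono_Suc_iff)
  have bb: "b k \<le> (1 / 2) ^ k" for k
  proof -
    have "1 * b k \<le> h k * b k" using h[of k] b(1)[of k] by (intro mult_right_mono) auto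
    then show ?thesis using b(2)[of k] by linarith
  qed
  have "summable (\<lambda>k. first (block_start h (Suc k)))"
    unfolding first_def using b(1) bb c(1)
    by (intro summable_comparison_test[OF _ summable_geometric[of "1 / 2"]]) (auto simp: less_imp_le)
  then have "summable (\<lambda>k. first (block_start h k))" by (subst (asm) summable_Suc_iff)
  then have "summable first"
    using summable_mono_reindex[OF start, of first] by (simp add: first_def)
  moreover have "summable (\<lambda>n. b (block h n))"
  proof (rule summable_suminf_not_top)
    show "0 \<le> b (block h n)" for n using b(1) by (simp add: less_imp_le)
    have "(\<Sum>n. ennreal (b (block h n))) \<le> (\<Sum>k. of_nat (h k) * ennreal (b k))"
      by (rule suminf_block_le[where l = h, OF h])
    also have "\<dots> \<le> (\<Sum>k. ennreal ((1 / 2) ^ k))"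
      using b by (intro suminf_le) (auto simp: ennreal_of_nat_eq_real_of_nat ennreal_mult[symmetric] less_imp_le intro!: ennreal_leI)
    also have "\<dots> < \<top>"
      by (subst suminf_ennreal2) (auto intro: summable_geometric)
    finally show "(\<Sum>n. ennreal (b (block h n))) \<noteq> \<top>" by simp
  qed
  moreover have "c n \<le> first n + b (block h n)" for n
    using c(2)[of n] b(1)[of "block h n"] by (cases "n = block_start h (block h n)") (auto simp: first_def less_imp_le)
  ultimately have "summable (\<lambda>n. first n + b (block h n))" "\<And>n. norm (c n) \<le> first n + b (block h n)"
    using c(3) by (simp_all add: summable_add)
  then show ?thesis by (rule summable_comparison_test'[where N = 0])
qed

context block_parameters
begin

lemma a_pos: "0 < a k"
  using b_pos[of k] b_less[of k] by linarith

lemma E_double: "2 * E k \<le> E (Suc k)"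
proof -
  have "(2 :: nat) * 1 \<le> 2 ^ (k + 3) * 4 ^ h (Suc k)"
    using power_increasing[of 1 "k + 3" "2 :: nat"] by (intro mult_mono) auto
  then have "2 * E k \<le> 2 ^ (k + 3) * 4 ^ h (Suc k) * E k" by (intro mult_right_mono) auto
  then show ?thesis by (simp only: E_Suc)
qed

lemma E_mono: "i \<le> j \<Longrightarrow> E i \<le> E j"
proof (rule lift_Suc_mono_le[of E])
  show "E k \<le> E (Suc k)" for k using E_double[of k] by simp
qed

lemma inverse_E_le: "1 / E k \<le> (1 / 2) ^ k"
proof -
  have "2 ^ k \<le> E k"
  proof (induction k)
    case (Suc k)
    then show ?case using E_double[of k] by simp
  qed (use E_ge_1[of 0] in simp)
  then have "real (2 ^ k) \<le> real (E k)" by (simp only: of_nat_le_iff)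
  then have "1 / real (E k) \<le> 1 / real (2 ^ k)" by (intro divide_left_mono) (use E_ge_1[of k] in auto)
  then show ?thesis by (simp add: power_divide)
qed

lemma a_le: "a k \<le> (1 / 2) ^ k"
proof (induction k)
  case (Suc k)
  then show ?case using b_less[of k] by (simp add: a_Suc)
qed (use a_le_1 in simp)

text \<open>The points \<open>a 0 > b 0 > a 1 > b 1 > \<dots>\<close> and their prescribed values are interleaved into single
  sequences. The values decrease because \<open>p (k + 1) < 1 / E (k + 1) \<le> 1 / (2 * E k)\<close>.\<close>

lemma exists_weight_distribution:
  obtains G where "weight_distribution_function G" "continuous_on {0..} G" "strict_mono_on {0..} G"
    "\<And>k. G (a k) = p k" "\<And>k. G (b k) = 1 / (2 * E k)"
proof -
  define x where "x j = (if even j then a (j div 2) else b (j div 2))" for j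
  define v where "v j = (if even j then p (j div 2) else 1 / (2 * E (j div 2)))" for j
  have half: "(\<lambda>j. (1 / 2 :: real) ^ (j div 2)) \<longlonglongrightarrow> 0"
  proof (rule filterlim_compose[OF LIMSEQ_power_zero])
    show "filterlim (\<lambda>j :: nat. j div 2) sequentially sequentially"
      unfolding filterlim_at_top
    proof
      fix N :: nat
      show "\<forall>\<^sub>F j in sequentially. N \<le> j div 2"
        using eventually_ge_at_top[of "2 * N"] by eventually_elim auto
    qed
  qed simp
  have x_lim: "x \<longlonglongrightarrow> 0"
  proof (rule tendsto_sandwich[OF _ _ tendsto_const half])
    show "\<forall>\<^sub>F j in sequentially. 0 \<le> x j"
      using a_pos b_pos by (auto simp: x_def less_imp_le)
    have "x j \<le> (1 / 2) ^ (j div 2)" for j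
      using a_le[of "j div 2"] b_less[of "j div 2"] by (simp add: x_def)
    then show "\<forall>\<^sub>F j in sequentially. x j \<le> (1 / 2) ^ (j div 2)" by simp
  qed
  have v_lim: "v \<longlonglongrightarrow> 0"
  proof (rule tendsto_sandwich[OF _ _ tendsto_const half])
    have "0 < p k" for k
    proof -
      have "0 \<le> 1 / real (2 * E k)" by simp
      then show ?thesis using p_gt[of k] by linarith
    qed
    then show "\<forall>\<^sub>F j in sequentially. 0 \<le> v j"
      by (auto simp: v_def less_imp_le)
    have "v j \<le> (1 / 2) ^ (j div 2)" for j
      using inverse_E_le[of "j div 2"] p_less[of "j div 2"] p_gt[of "j div 2"] by (simp add: v_def)
    then show "\<forall>\<^sub>F j in sequentially. v j \<le> (1 / 2) ^ (j div 2)" by simp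
  qed
  have x_dec: "x (Suc j) < x j" for j
  proof (cases "even j")
    case True
    then show ?thesis using b_less[of "j div 2"] by (simp add: x_def)
  next
    case False
    then obtain k where "j = 2 * k + 1" by (elim oddE)
    then show ?thesis using b_pos[of k] by (simp add: x_def a_Suc)
  qed
  have v_dec: "v (Suc j) < v j" for j
  proof (cases "even j")
    case True
    then show ?thesis using p_gt[of "j div 2"] by (simp add: v_def)
  next
    case False
    then obtain k where k: "j = 2 * k + 1" by (elim oddE)
    have "p (Suc k) < 1 / E (Suc k)" by (rule p_less)
    also have "\<dots> \<le> 1 / real (2 * E k)"
      using E_double[of k] E_ge_1[of k] by (intro divide_left_mono) (auto simp flip: of_nat_le_iff)
    finally show ?thesis by (simp add: v_def k)
  qed
  have v_0: "v 0 < 1"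
    using p_less[of 0] inverse_E_le[of 0] by (simp add: v_def)
  obtain G where G: "weight_distribution_function G" "continuous_on {0..} G" "strict_mono_on {0..} G"
    and G_x: "\<And>j. G (x j) = v j"
    using exists_weight_distribution_through[OF x_dec x_lim v_dec v_lim v_0] by blast
  have G_a: "G (a k) = p k" for k using G_x[of "2 * k"] by (simp add: x_def v_def)
  have G_b: "G (b k) = 1 / (2 * E k)" for k using G_x[of "2 * k + 1"] by (simp add: x_def v_def)
  show thesis by (rule that[OF G G_a G_b])
qed

text \<open>Call an edge of block \<open>k\<close> good if its weight is at most \<open>b k\<close>, which has probability \<open>1 / (2 * E k)\<close>.
  A node then has on average one good child for \<open>critical_degree\<close> and half a good child for
  \<open>subcritical_degree\<close>.\<close>

definition critical_degree :: "nat \<Rightarrow> nat" where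
  "critical_degree n = 2 * E (block L n)"

definition subcritical_degree :: "nat \<Rightarrow> nat" where
  "subcritical_degree n = E (block h n)"

lemma mono_critical_degree: "mono critical_degree"
  unfolding critical_degree_def
  by (intro monoI mult_left_mono E_mono mono_block[where l = L, OF L_ge_1]) auto

lemma critical_degree_ge_1: "1 \<le> critical_degree n"
  using E_ge_1[of "block L n"] by (simp add: critical_degree_def)

lemma mono_subcritical_degree: "mono subcritical_degree"
  unfolding subcritical_degree_def
  by (intro monoI E_mono mono_block[where l = h, OF h_ge_1])

lemma subcritical_degree_ge_1: "1 \<le> subcritical_degree n"
  unfolding subcritical_degree_def by (rule E_ge_1)

context
  fixes G :: "real \<Rightarrow> real"
  assumes G: "weight_distribution_function G" and strict: "strict_mono_on {0..} G"
    and G_a: "\<And>k. G (a k) = p k" and G_b: "\<And>k. G (b k) = 1 / (2 * E k)"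
begin

lemmas law = weight_law[OF G]

lemma G_small_critical_degree: "G_small G critical_degree"
proof -
  have "(\<Sum>n. quantile G (inverse (real (critical_degree n)))) \<le> (\<Sum>k. of_nat (L k) * quantile G (inverse (real (2 * E k))))"
    unfolding critical_degree_def by (rule suminf_block_le[where l = L, OF L_ge_1])
  also have "\<dots> \<le> (\<Sum>k. ennreal ((1 / 2) ^ k))"
  proof (intro suminf_le summableI)
    fix k
    have "of_nat (L k) * quantile G (inverse (real (2 * E k))) \<le> of_nat (L k) * ennreal (b k)"
      using b_pos[of k] by (intro mult_left_mono quantile_le) (simp_all add: G_b inverse_eq_divide)
    also have "\<dots> = ennreal (L k * b k)"
      using b_pos[of k] by (simp add: ennreal_of_nat_eq_real_of_nat ennreal_mult)
    also have "\<dots> \<le> ennreal ((1 / 2) ^ k)" by (intro ennreal_leI L_b)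
    finally show "of_nat (L k) * quantile G (inverse (real (2 * E k))) \<le> ennreal ((1 / 2) ^ k)" .
  qed
  also have "\<dots> < \<infinity>"
    by (subst suminf_ennreal2) (auto intro: summable_geometric)
  finally show ?thesis unfolding G_small_def by (intro exI[of _ 0]) simp
qed

lemma not_G_explosive_critical_degree: "\<not> G_explosive G critical_degree"
  unfolding G_explosive_def random_tree_weights_def
proof (rule not_AE_explosive[OF critical_degree_ge_1 law(1,3), where t = "block_start L" and r = h and a = a and \<epsilon> = "\<lambda>k. (1 / 2) ^ (k + 2)"])
  show "block_start L k \<le> block_start L (Suc k)" for k by (intro mono_block_start) simp
  have "(\<lambda>k. (1 / 4) * (1 / 2 :: real) ^ k) sums ((1 / 4) * (1 / (1 - 1 / 2)))"
    by (intro sums_mult geometric_sums) simp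
  then have "(\<lambda>k. (1 / 2 :: real) ^ (k + 2)) sums (1 / 2)" by (simp add: power2_eq_square)
  then show "summable (\<lambda>k. (1 / 2 :: real) ^ (k + 2))" "(\<Sum>k. (1 / 2 :: real) ^ (k + 2)) < 1"
    by (auto simp only: sums_iff)
  fix k
  let ?t = "block_start L k" and ?p = "\<lambda>n. if n < block_start L k then 1 else cdf (interval_measure G) (a k)"
  have pk: "0 \<le> p k" "p k \<le> 1"
  proof -
    have "0 \<le> 1 / real (2 * E k)" "(1 / 2 :: real) ^ k \<le> 1" by (auto intro: power_le_one)
    then show "0 \<le> p k" "p k \<le> 1" using p_gt[of k] p_less[of k] inverse_E_le[of k] by linarith+
  qed
  have "block L (?t + i) = k" if "i < L k" for i
    using that by (intro block_eqI[where l = L, OF L_ge_1]) (auto simp: block_start_Suc)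
  then have "descent_prob critical_degree ?p (L k) (h k) ?t = descent_prob (\<lambda>_. 2 * E k) (\<lambda>_. p k) (L k) (h k) 0"
    by (intro descent_prob_cong) (simp_all add: critical_degree_def law(2) G_a)
  moreover have "(\<Prod>i<?t. real (critical_degree i)) = (\<Prod>j<k. real (2 * E j) ^ L j)"
    using prod_block[where l = L, OF L_ge_1, of "\<lambda>k. real (2 * E k)" k] by (simp add: critical_degree_def)
  moreover have "descent_prob critical_degree ?p (?t + L k) (h k) 0
      \<le> (\<Prod>i<?t. real (critical_degree (0 + i))) * descent_prob critical_degree ?p (L k) (h k) (0 + ?t)"
    using pk by (intro descent_prob_union_bound) (auto simp: law(2) G_a)
  ultimately show "descent_prob critical_degree ?p (block_start L (Suc k)) (h k) 0 \<le> (1 / 2) ^ (k + 2)"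
    using die_out[of k] unfolding block_start_Suc add_0 by (simp only:)
  show "0 \<le> a k" using a_pos[of k] by simp
  show "1 \<le> real (h k) * a k" by (rule h_a)
qed

lemma G_explosive_subcritical_degree: "G_explosive G subcritical_degree"
  unfolding G_explosive_def random_tree_weights_def
proof -
  \<comment> \<open>The value at the root is immaterial; excluding it avoids the index \<open>0 - 1\<close>.\<close>
  define c where "c n = (if n = block_start h (block h n) \<and> 0 < n then b (block h n - 1) else b (block h n))" for n
  have start: "block h (block_start h k) = k" for k by (rule block_block_start[where l = h, OF h_ge_1])
  have pos: "0 < block_start h (Suc k)" for k
    using block_start_ge[where l = h, OF h_ge_1, of "Suc k"] by simp
  have c_first: "c (block_start h (Suc k)) = b k" for k using pos[of k] by (simp add: c_def start)
  have c_later: "c n = b (block h n)" if "n \<noteq> block_start h (block h n)" for n using that by (simp add: c_def)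
  have c_nonneg: "0 \<le> c n" for n using b_pos by (simp add: c_def less_imp_le)
  show "AE w in PiM (tree_edges subcritical_degree) (\<lambda>_. interval_measure G). explosive subcritical_degree w"
  proof (rule AE_explosive[OF subcritical_degree_ge_1 law(1,3), where c = c])
    show "summable c"
      by (rule summable_block_cost[OF h_ge_1 b_pos h_b c_first c_later c_nonneg])
    fix \<epsilon> :: real assume "0 < \<epsilon>"
    then obtain K where K: "(1 / 2) ^ K < \<epsilon>" using real_arch_pow_inv[of \<epsilon> "1 / 2"] by auto
    let ?u = "block_start h (Suc K)"
    let ?p = "\<lambda>n. if n < ?u then 1 else cdf (interval_measure G) (c n)"
    have "1 - 1 / 2 ^ K \<le> descent_prob (\<lambda>n. E (block h n)) ?p m 1 0" for m
    proof (rule survival_lower_bound[OF h_ge_1 E_ge_1 E_Suc])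
      fix k assume "K \<le> k"
      then have "?u \<le> block_start h (Suc k)" by (intro mono_block_start) simp
      then show "?p (block_start h (Suc k)) = 1 / (2 * E k)" by (simp add: law(2) c_first G_b)
    next
      fix n assume "?u \<le> n" "n \<noteq> block_start h (block h n)"
      then show "?p n = 1 / (2 * E (block h n))" by (simp add: law(2) c_later G_b)
    qed simp
    then have "1 - \<epsilon> \<le> descent_prob subcritical_degree ?p m 1 0" for m
      using K unfolding subcritical_degree_def by (smt (verit) power_one_over)
    then show "\<exists>K. \<forall>m. 1 - \<epsilon> \<le> descent_prob subcritical_degree (\<lambda>n. if n < K then 1 else cdf (interval_measure G) (c n)) m 1 0"
      by blast
  qed (rule c_nonneg)
qed

lemma not_G_small_subcritical_degree: "\<not> G_small G subcritical_degree"
proof -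
  have "1 \<le> of_nat (h k) * quantile G (inverse (real (E k)))" for k
  proof -
    have "1 \<le> ennreal (h k * a k)" unfolding ennreal_1[symmetric] by (intro ennreal_leI h_a)
    also have "\<dots> = of_nat (h k) * ennreal (a k)"
      using a_pos[of k] by (simp add: ennreal_of_nat_eq_real_of_nat ennreal_mult)
    also have "\<dots> \<le> of_nat (h k) * quantile G (inverse (real (E k)))"
      using a_pos[of k] p_less[of k] by (intro mult_left_mono quantile_ge strict) (simp_all add: G_a inverse_eq_divide)
    finally show ?thesis .
  qed
  then have "(\<Sum>n. quantile G (inverse (real (subcritical_degree (n + N))))) = \<infinity>" for N
    unfolding subcritical_degree_def by (rule suminf_block_tail_eq_top[where l = h, OF h_ge_1])
  then show ?thesis unfolding G_small_def by simp
qed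

end

end

theorem proposition1p8:
  shows "\<exists>(G :: real \<Rightarrow> real) (f1 :: nat \<Rightarrow> nat) (f2 :: nat \<Rightarrow> nat).
    weight_distribution_function G \<and> continuous_on {0..} G \<and> strict_mono_on {0..} G \<and>
    mono f1 \<and> (\<forall>n. 1 \<le> f1 n) \<and> mono f2 \<and> (\<forall>n. 1 \<le> f2 n) \<and>
    (G_small G f1 \<and> \<not> G_explosive G f1) \<and>
    (G_explosive G f2 \<and> \<not> G_small G f2)"
proof -
  obtain E h L a b p where "block_parameters E h L a b p"
    using exists_block_parameters by blast
  then interpret block_parameters E h L a b p .
  obtain G where G: "weight_distribution_function G" "continuous_on {0..} G" "strict_mono_on {0..} G"
    and G_at: "\<And>k. G (a k) = p k" "\<And>k. G (b k) = 1 / (2 * E k)"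
    using exists_weight_distribution by blast
  note points = G(1,3) G_at
  show ?thesis
    using G mono_critical_degree critical_degree_ge_1 mono_subcritical_degree subcritical_degree_ge_1
      G_small_critical_degree[OF points] not_G_explosive_critical_degree[OF points]
      G_explosive_subcritical_degree[OF points] not_G_small_subcritical_degree[OF points]
    by blast
qed

end
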